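(* Let $K$ be an algebraically closed field. Set $G:=\mathrm{GL}_3(K)\times H$, where \[H:=\left\{\begin{bmatrix}1&0\\ \lambda&\mu\end{bmatrix}\ \middle|\ \lambda,\mu\in K,\ \mu\ne0\right\}\le\mathrm{GL}_2(K).\] There are $12$ $G$-orbits in $\mathcal{N}_{3,2}$, namely: \begin{align*} G\cdot A_{0,1}&=\mathrm{GL}_3(K)\cdot\{A_{\lambda,\mu}\mid\lambda,\mu\in K,\mu\ne0\}\\ G\cdot A_{0,\infty}&=\mathrm{GL}_3(K)\cdot\{A_{\lambda,\infty}\mid\lambda\in K\}\\ G\cdot A_{\infty,0}&=\mathrm{GL}_3(K)\cdot\{A_{\infty,\lambda}\mid\lambda\in K\}\\ G\cdot B_{0,1}&=\mathrm{GL}_3(K)\cdot\{B_{\lambda,\mu}\mid\lambda,\mu\in K,\mu\ne0\}\\ G\cdot B_{0,0}&=\mathrm{GL}_3(K)\cdot\{B_{\lambda,0}\mid\lambda\in K\}\\ G\cdot B_{\infty,0}&=\mathrm{GL}_3(K)\cdot B_{\infty,0}\\ G\cdot B_{\infty,1}&=\mathrm{GL}_3(K)\cdot\{B_{\infty,\lambda}\mid\lambda\in K,\lambda\ne0\}\\ G\cdot C&=\mathrm{GL}_3(K)\cdot C\\ G\cdot D&=\mathrm{GL}_3(K)\cdot D\\ G\cdot E_0&=\mathrm{GL}_3(K)\cdot\{E_\lambda\mid\lambda\in K\}\\ G\cdot E_\infty&=\mathrm{GL}_3(K)\cdot E_\infty\\ G\cdot O&=\{O\}. \end{align*} Moreover,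 the edges of the Hasse diagram of the degeneration order for the $G$-orbits in $\mathcal{N}_{3,2}$ are exactly the following, where $X\to Y$ means that $G\cdot Y$ is a minimal degeneration of $G\cdot X$: \[\begin{aligned} &A_{0,1}\to A_{0,\infty},\quad A_{0,1}\to A_{\infty,0},\quad A_{0,1}\to B_{0,1},\\ &B_{0,1}\to B_{0,0},\quad B_{0,1}\to B_{\infty,1},\quad A_{0,\infty}\to B_{\infty,1},\quad A_{\infty,0}\to B_{\infty,1},\\ &B_{\infty,1}\to C,\quad B_{\infty,1}\to D,\quad B_{\infty,1}\to B_{\infty,0},\\ &B_{0,0}\to B_{\infty,0},\quad B_{0,0}\to E_0,\quad B_{\infty,0}\to E_\infty,\\ &C\to E_0,\quad D\to E_0,\quad E_0\to E_\infty,\quad E_\infty\to O. \end{aligned}\]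
   Context: $E_{ij}$ denotes the $3\times 3$ matrix unit with entry $1$ in position $(i,j)$ and $0$ elsewhere. $\mathrm{GL}_3(K)$ acts on $(K^{3\times 3})^2$ by simultaneous conjugation, $g\cdot(A_1,A_2)=(gA_1g^{-1},gA_2g^{-1})$. $\mathrm{GL}_2(K)$ acts by $\begin{bmatrix} g_{11} & g_{12} \\ g_{21} & g_{22} \end{bmatrix}\cdot(A_1,A_2)=(g_{11}A_1+g_{12}A_2,\ g_{21}A_1+g_{22}A_2)$. The two actions commute, giving an action of $\mathrm{GL}_3(K)\times\mathrm{GL}_2(K)$ (and its subgroup $G$). $\mathcal{N}_{3,2}$ is the set of pairs $(A_1,A_2)\in (K^{3\times 3})^2$ such that $A_1,A_2$ generate a nilpotent (non-unital) subalgebra of $K^{3\times 3}$; it is preserved by this action. Named pairs: $A_{\lambda,\mu}=(E_{21}+E_{32},\lambda(E_{21}+E_{32})+\mu E_{32})$ ($\lambda,\mu\in K$, $\mu\ne0$); $A_{\lambda,\infty}=(E_{21},\lambda E_{21}+E_{32})$ ($\lambda\in K$); $A_{\infty,\lambda}=(E_{32},E_{21}+\lambda E_{32})$ ($\lambda\in K$); $B_{\lambda,\mu}=(E_{21}+E_{32},\lambda(E_{21}+E_{32})+\mu E_{31})$ ($\lambda,\mu\in K$); $B_{\infty,\lambda}=(\lambda E_{31},E_{21}+E_{32})$ ($\lambda\in K$); $C=(E_{21},E_{31})$; $D=(E_{31},E_{32})$; $E_\lambda=(E_{21},\lambda E_{21})$ ($\lambda\in K$); $E_\infty=(0,E_{21})$;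 $O=(0,0)$. Degeneration order on $G$-orbits: $G\cdot X$ degenerates to $G\cdot Y$ if $G\cdot Y\subseteq\overline{G\cdot X}$ (Zariski closure). $G\cdot Y$ is a minimal degeneration of $G\cdot X$ if the two orbits are different, $G\cdot X$ degenerates to $G\cdot Y$, and there is no third orbit $G\cdot Z$ with $G\cdot X$ degenerating to $G\cdot Z$ and $G\cdot Z$ degenerating to $G\cdot Y$. *)

theory Defs
  imports "HOL-Analysis.Analysis" "HOL-Computational_Algebra.Polynomial"
begin

section \<open>Matrix pairs and group actions\<close>

type_synonym 'a mat_pair = "('a^3^3) \<times> ('a^3^3)"

definition mat_scale :: "'a::semiring_1 \<Rightarrow> 'a^'n^'m \<Rightarrow> 'a^'n^'m"  (infixr \<open>*\<^sub>m\<close> 75)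
  where "c *\<^sub>m A = (\<chi> i j. c * A $ i $ j)"

definition GL :: "('a::field^'n^'n) set"
  where "GL = {g. invertible g}"

definition conj_act :: "'a::field^3^3 \<Rightarrow> 'a mat_pair \<Rightarrow> 'a mat_pair"
  where "conj_act g A = (g ** fst A ** matrix_inv g, g ** snd A ** matrix_inv g)"

definition mix_act :: "'a::field^2^2 \<Rightarrow> 'a mat_pair \<Rightarrow> 'a mat_pair"
  where "mix_act h A =
    (h $ 1 $ 1 *\<^sub>m fst A + h $ 1 $ 2 *\<^sub>m snd A,
     h $ 2 $ 1 *\<^sub>m fst A + h $ 2 $ 2 *\<^sub>m snd A)"

definition H_group :: "('a::field^2^2) set"
  where "H_group = {vector [vector [1, 0], vector [l, m]] | l m. m \<noteq> 0}"

lemma H_group_subset_GL: "H_group \<subseteq> (GL :: ('a::field^2^2) set)"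
  by (auto simp: H_group_def GL_def invertible_det_nz det_2)

definition GL3_sat :: "'a::field mat_pair set \<Rightarrow> 'a mat_pair set"
  where "GL3_sat S = {conj_act g A | g A. g \<in> GL \<and> A \<in> S}"

definition G_orbit :: "'a::field mat_pair \<Rightarrow> 'a mat_pair set"
  where "G_orbit A = {conj_act g (mix_act h A) | g h. g \<in> GL \<and> h \<in> H_group}"


section \<open>Pairs generating a nilpotent subalgebra\<close>

definition subalgebra :: "('a::field^'n^'n) set \<Rightarrow> bool"
  where "subalgebra S \<longleftrightarrow> 0 \<in> S \<and> (\<forall>A\<in>S. \<forall>B\<in>S. A + B \<in> S) \<and>
    (\<forall>c. \<forall>A\<in>S. c *\<^sub>m A \<in> S) \<and> (\<forall>A\<in>S. \<forall>B\<in>S. A ** B \<in> S)"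

definition nilpotent_algebra :: "('a::field^'n^'n) set \<Rightarrow> bool"
  where "nilpotent_algebra S \<longleftrightarrow>
    (\<exists>n\<ge>1. \<forall>As. length As = n \<and> set As \<subseteq> S \<longrightarrow> foldr (**) As (mat 1) = 0)"

definition nilp_pairs :: "'a::field mat_pair set"
  where "nilp_pairs = {(A, B). nilpotent_algebra (subalgebra hull {A, B})}"


section \<open>Zariski topology and degenerations\<close>

inductive_set poly_funs :: "('a::field mat_pair \<Rightarrow> 'a) set" where
  const: "(\<lambda>_. c) \<in> poly_funs"
| coord_fst: "(\<lambda>A. fst A $ i $ j) \<in> poly_funs"
| coord_snd: "(\<lambda>A. snd A $ i $ j) \<in> poly_funs"
| add: "p \<in> poly_funs \<Longrightarrow> q \<in> poly_funs \<Longrightarrow> (\<lambda>A. p A + q A) \<in> poly_funs"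
| mult: "p \<in> poly_funs \<Longrightarrow> q \<in> poly_funs \<Longrightarrow> (\<lambda>A. p A * q A) \<in> poly_funs"

definition zariski_closed :: "'a::field mat_pair set \<Rightarrow> bool"
  where "zariski_closed Z \<longleftrightarrow> (\<exists>P\<subseteq>poly_funs. Z = {A. \<forall>p\<in>P. p A = 0})"

definition zariski_closure :: "'a::field mat_pair set \<Rightarrow> 'a mat_pair set"
  where "zariski_closure S = zariski_closed hull S"

definition degenerates :: "'a::field mat_pair \<Rightarrow> 'a mat_pair \<Rightarrow> bool"
  where "degenerates X Y \<longleftrightarrow> G_orbit Y \<subseteq> zariski_closure (G_orbit X)"

definition minimal_degeneration :: "'a::field mat_pair \<Rightarrow> 'a mat_pair \<Rightarrow> bool"
  where "minimal_degeneration X Y \<longleftrightarrow> G_orbit X \<noteq> G_orbit Y \<and> degenerates X Y \<and>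
    \<not> (\<exists>Z. G_orbit Z \<noteq> G_orbit X \<and> G_orbit Z \<noteq> G_orbit Y \<and> degenerates X Z \<and> degenerates Z Y)"


section \<open>The named pairs\<close>

definition mat_unit :: "'n \<Rightarrow> 'n \<Rightarrow> 'a::field^'n^'n"
  where "mat_unit i j = (\<chi> a b. if a = i \<and> b = j then 1 else 0)"

abbreviation "E21 \<equiv> mat_unit 2 1 :: 'a::field^3^3"
abbreviation "E31 \<equiv> mat_unit 3 1 :: 'a::field^3^3"
abbreviation "E32 \<equiv> mat_unit 3 2 :: 'a::field^3^3"

text \<open>The suffixes \<open>_linf\<close> and \<open>_infl\<close> mark the index pairs $(\lambda,\infty)$ and
  $(\infty,\lambda)$; \<open>_inf\<close> marks the single index $\infty$.\<close>

definition pair_A :: "'a::field \<Rightarrow> 'a \<Rightarrow> 'a mat_pair"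
  where "pair_A l m = (E21 + E32, l *\<^sub>m (E21 + E32) + m *\<^sub>m E32)"

definition pair_A_linf :: "'a::field \<Rightarrow> 'a mat_pair"
  where "pair_A_linf l = (E21, l *\<^sub>m E21 + E32)"

definition pair_A_infl :: "'a::field \<Rightarrow> 'a mat_pair"
  where "pair_A_infl l = (E32, E21 + l *\<^sub>m E32)"

definition pair_B :: "'a::field \<Rightarrow> 'a \<Rightarrow> 'a mat_pair"
  where "pair_B l m = (E21 + E32, l *\<^sub>m (E21 + E32) + m *\<^sub>m E31)"

definition pair_B_infl :: "'a::field \<Rightarrow> 'a mat_pair"
  where "pair_B_infl l = (l *\<^sub>m E31, E21 + E32)"

definition pair_C :: "'a::field mat_pair"
  where "pair_C = (E21, E31)"

definition pair_D :: "'a::field mat_pair"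
  where "pair_D = (E31, E32)"

definition pair_E :: "'a::field \<Rightarrow> 'a mat_pair"
  where "pair_E l = (E21, l *\<^sub>m E21)"

definition pair_E_inf :: "'a::field mat_pair"
  where "pair_E_inf = (0, E21)"

definition pair_O :: "'a::field mat_pair"
  where "pair_O = (0, 0)"

end

theory Submission
  imports Defs
begin

text \<open>
  Engel's theorem for these small matrices says that \<open>(A, B)\<close> generates a nilpotent algebra exactly if
  the two matrices are simultaneously conjugate to strictly lower triangular ones
  (\<open>nilp_pairs_triangularizable\<close>, \<open>triangularizable_nilp_pairs\<close>), equivalently if every product of
  three factors from \<open>{A, B}\<close> vanishes (\<open>nilp_pairs_iff_TriplesZero\<close>). The last description is closed,
  so a degeneration of a nilpotent pair is nilpotent and minimality may be tested inside
  \<open>nilp_pairs\<close>.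

  A strictly lower triangular pair has six coordinates: the entries \<open>a, b, c\<close> and \<open>a', b', c'\<close> at the
  positions 21, 32, 31 of the two matrices. Up to scaling, \<open>(a, a')\<close> and \<open>(b, b')\<close> are points of the
  projective line, on which the group \<open>H\<close> acts as the affine group fixing \<open>(0, 1)\<close>. If the two points
  differ, \<open>(c, c')\<close> can be conjugated away and only their position relative to the fixed point
  remains (the three \<open>A\<close> orbits). If they agree, it also matters whether \<open>(c, c')\<close> is proportional to
  them (the four \<open>B\<close> orbits). If one of the vectors vanishes, all products vanish and the pair is a pair
  of vectors or covectors (\<open>C\<close>, \<open>D\<close>, \<open>E\<close>, \<open>O\<close>). The predicate \<open>shape\<close> records these
  alternatives, and \<open>shape_normal_form\<close> gives an explicit change of basis into the normal form for each.

  Since the orbit of a triangular pair is read off from polynomial conditions on its coordinates, each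
  of the seventeen degenerations is realized by an affine line in the space of triangular pairs whose points
  off the origin have the first shape and whose origin has the second (\<open>edge_degenerates\<close>). In the
  other direction, ten conditions that are closed and invariant under the group, such as \<open>A = 0\<close>,
  \<open>A B = B A\<close> or linear dependence, are inherited by degenerations. The sets \<open>profile t\<close> of conditions
  satisfied by the twelve representatives are distinct, and whenever \<open>profile s\<close> is contained in
  \<open>profile t\<close> there is a path of edges from \<open>s\<close> to \<open>t\<close>. Hence degeneration is inclusion of profiles
  (\<open>degenerates_rep_iff\<close>), the orbits are distinct, and the Hasse diagram is that of a finite poset of
  finite sets.
\<close>

section \<open>Matrix algebra and orbits\<close>

lemma mat_scale_nth [simp]: "(c *\<^sub>m A) $ i $ j = c * A $ i $ j"
  by (simp add: mat_scale_def)

lemma mat_scale_mult_left: "(c *\<^sub>m A) ** B = c *\<^sub>m (A ** B)"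
  for A :: "'a::field^'n^'m"
  by (simp add: vec_eq_iff matrix_matrix_mult_def sum_distrib_left mult.assoc)

lemma mat_scale_mult_right: "A ** (c *\<^sub>m B) = c *\<^sub>m (A ** B)"
  for A :: "'a::field^'n^'m"
  by (simp add: vec_eq_iff matrix_matrix_mult_def sum_distrib_left mult.left_commute)

lemma mat_scale_add_right: "c *\<^sub>m (A + B) = c *\<^sub>m A + c *\<^sub>m B"
  for A :: "'a::field^'n^'m"
  by (simp add: vec_eq_iff algebra_simps)

lemma mat_scale_add_left: "(c + d) *\<^sub>m A = c *\<^sub>m A + d *\<^sub>m A"
  for A :: "'a::field^'n^'m"
  by (simp add: vec_eq_iff algebra_simps)

lemma mat_scale_scale: "c *\<^sub>m (d *\<^sub>m A) = (c * d) *\<^sub>m A"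
  for A :: "'a::field^'n^'m"
  by (simp add: vec_eq_iff algebra_simps)

lemma mat_scale_simps [simp]:
  "0 *\<^sub>m A = 0" "1 *\<^sub>m A = A" "c *\<^sub>m 0 = 0" for A :: "'a::field^'n^'m"
  by (simp_all add: vec_eq_iff)

lemma trace_mat_scale: "trace (c *\<^sub>m A) = c * trace A" for A :: "'a::field^'n^'n"
  by (simp add: trace_def sum_distrib_left)

lemma matrix_add_rdistrib: "(A + B) ** C = A ** C + B ** C"
  for A :: "'a::field^'n^'m"
  by (simp add: vec_eq_iff matrix_matrix_mult_def sum.distrib distrib_right)

lemmas mat_scale_algebra = mat_scale_mult_left mat_scale_mult_right mat_scale_add_right
  mat_scale_add_left mat_scale_scale matrix_add_ldistrib matrix_add_rdistrib

lemma GL_iff_det: "g \<in> GL \<longleftrightarrow> det g \<noteq> 0"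
  by (simp add: GL_def invertible_det_nz)

lemma GL_inv:
  assumes "g \<in> GL"
  shows "g ** matrix_inv g = mat 1" "matrix_inv g ** g = mat 1" "matrix_inv g \<in> GL"
proof -
  have "\<exists>h. g ** h = mat 1 \<and> h ** g = mat 1"
    using assms by (simp add: GL_def invertible_def)
  then have "g ** matrix_inv g = mat 1 \<and> matrix_inv g ** g = mat 1"
    unfolding matrix_inv_def by (rule someI_ex)
  then show "g ** matrix_inv g = mat 1" "matrix_inv g ** g = mat 1" "matrix_inv g \<in> GL"
    by (auto simp: GL_def invertible_def)
qed

lemma GL_mult: "g \<in> GL \<Longrightarrow> h \<in> GL \<Longrightarrow> g ** h \<in> GL"
  by (simp add: GL_def invertible_mult)

lemma one_in_GL: "mat 1 \<in> GL"
  by (simp add: GL_iff_det)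

lemma GL_cancel [simp]:
  assumes "g \<in> GL"
  shows "g ** (matrix_inv g ** X) = X" "matrix_inv g ** (g ** X) = X"
  using GL_inv[OF assms] by (simp_all add: matrix_mul_assoc)

lemma matrix_inv_mult:
  assumes "g \<in> GL" "h \<in> GL"
  shows "matrix_inv (g ** h) = matrix_inv h ** matrix_inv g"
proof -
  have "matrix_inv (g ** h) = matrix_inv (g ** h) ** ((g ** h) ** (matrix_inv h ** matrix_inv g))"
    using assms by (simp add: matrix_mul_assoc[symmetric] GL_inv)
  also have "\<dots> = matrix_inv h ** matrix_inv g"
    using GL_mult[OF assms] by simp
  finally show ?thesis .
qed

lemma conj_mult:
  assumes "g \<in> GL"
  shows "(g ** X ** matrix_inv g) ** (g ** Y ** matrix_inv g) = g ** (X ** Y) ** matrix_inv g"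
  using assms by (simp add: matrix_mul_assoc[symmetric])

lemma conj_act_mult: "g \<in> GL \<Longrightarrow> h \<in> GL \<Longrightarrow> conj_act g (conj_act h X) = conj_act (g ** h) X"
  by (simp add: conj_act_def matrix_inv_mult matrix_mul_assoc)

lemma conj_act_one [simp]: "conj_act (mat 1) X = X"
proof -
  have "matrix_inv (mat 1 :: 'a^3^3) = mat 1"
    using GL_inv(1)[OF one_in_GL] by (metis matrix_mul_lid)
  then show ?thesis
    by (simp add: conj_act_def)
qed

text \<open>
  Clearing the inverse turns conjugacy into polynomial identities, which can be checked entry by entry.
\<close>

lemma conj_actI:
  assumes "det g \<noteq> 0" "g ** A = A' ** g" "g ** B = B' ** g"
  shows "(A', B') = conj_act g (A, B)"
proof -
  have "g \<in> GL" using assms(1) by (simp add: GL_iff_det)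
  then show ?thesis
    using assms by (simp add: conj_act_def matrix_mul_assoc[symmetric] GL_inv)
qed

text \<open>
  The action of the element of \<open>H\<close> with second row \<open>(l, m)\<close>.
\<close>

definition shear :: "'a::field \<Rightarrow> 'a \<Rightarrow> 'a mat_pair \<Rightarrow> 'a mat_pair"
  where "shear l m X = (fst X, l *\<^sub>m fst X + m *\<^sub>m snd X)"

lemma mix_act_H: "mix_act (vector [vector [1, 0], vector [l, m]]) X = shear l m X"
  by (simp add: mix_act_def shear_def vector_2)

lemma G_orbit_shear: "G_orbit X = {conj_act g (shear l m X) | g l m. g \<in> GL \<and> m \<noteq> 0}"
  by (auto simp: G_orbit_def H_group_def mix_act_H) (metis mix_act_H)+

lemma shear_conj_act: "shear l m (conj_act g X) = conj_act g (shear l m X)"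
  by (simp add: shear_def conj_act_def mat_scale_algebra)

lemma shear_shear: "shear l m (shear l' m' X) = shear (l + m * l') (m * m') X"
  by (simp add: shear_def mat_scale_algebra add.assoc)

lemma shear_id [simp]: "shear 0 1 X = X"
  by (simp add: shear_def)

lemma G_orbitI: "g \<in> GL \<Longrightarrow> m \<noteq> 0 \<Longrightarrow> conj_act g (shear l m X) \<in> G_orbit X"
  by (auto simp: G_orbit_shear)

lemma G_orbitE:
  assumes "Y \<in> G_orbit X"
  obtains g l m where "g \<in> GL" "m \<noteq> 0" "Y = conj_act g (shear l m X)"
  using assms by (auto simp: G_orbit_shear)

lemma G_orbit_refl: "X \<in> G_orbit X"
  using G_orbitI[OF one_in_GL, of 1 0 X] by simp

lemma G_orbit_conj: "g \<in> GL \<Longrightarrow> conj_act g X \<in> G_orbit X"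
  using G_orbitI[of g 1 0 X] by simp

lemma G_orbit_of_shear: "m \<noteq> 0 \<Longrightarrow> shear l m X \<in> G_orbit X"
  using G_orbitI[OF one_in_GL, of m l X] by simp

lemma G_orbit_trans:
  assumes "Y \<in> G_orbit X" "Z \<in> G_orbit Y"
  shows "Z \<in> G_orbit X"
proof -
  obtain g l m where Y: "g \<in> GL" "m \<noteq> 0" "Y = conj_act g (shear l m X)"
    using assms(1) by (rule G_orbitE)
  obtain h k n where Z: "h \<in> GL" "n \<noteq> 0" "Z = conj_act h (shear k n Y)"
    using assms(2) by (rule G_orbitE)
  have "Z = conj_act (h ** g) (shear (k + n * l) (n * m) X)"
    using Y Z by (simp add: shear_conj_act conj_act_mult shear_shear)
  then show ?thesis
    using Y Z by (simp add: G_orbitI GL_mult)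
qed

lemma G_orbit_sym:
  assumes "Y \<in> G_orbit X"
  shows "X \<in> G_orbit Y"
proof -
  obtain g l m where Y: "g \<in> GL" "m \<noteq> 0" "Y = conj_act g (shear l m X)"
    using assms by (rule G_orbitE)
  have "conj_act (matrix_inv g) (shear (- l / m) (1 / m) Y) = X"
    using Y by (simp add: shear_conj_act conj_act_mult shear_shear GL_inv)
  then show ?thesis
    using Y G_orbitI[of "matrix_inv g" "1 / m" "- l / m" Y] by (simp add: GL_inv)
qed

lemma G_orbit_eq: "Y \<in> G_orbit X \<Longrightarrow> G_orbit Y = G_orbit X"
  by (meson G_orbit_sym G_orbit_trans subsetI subset_antisym)

section \<open>Polynomial functions and Zariski closures\<close>

lemma poly_funs_diff:
  assumes "p \<in> poly_funs" "q \<in> poly_funs"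
  shows "(\<lambda>X. p X - q X) \<in> poly_funs"
  using poly_funs.add[OF assms(1) poly_funs.mult[OF poly_funs.const[of "-1"] assms(2)]] by simp

lemma poly_funs_sum:
  assumes "finite I" "\<And>i. i \<in> I \<Longrightarrow> f i \<in> poly_funs"
  shows "(\<lambda>X. \<Sum>i\<in>I. f i X) \<in> poly_funs"
  using assms by (induction I rule: finite_induct) (auto intro: poly_funs.intros)

definition poly_mat :: "('a::field mat_pair \<Rightarrow> 'a^3^3) \<Rightarrow> bool"
  where "poly_mat F \<longleftrightarrow> (\<forall>i j. (\<lambda>X. F X $ i $ j) \<in> poly_funs)"

lemma poly_mat_intros:
  "poly_mat fst" "poly_mat snd" "poly_mat (\<lambda>_. M)"
  "poly_mat F \<Longrightarrow> poly_mat F' \<Longrightarrow> poly_mat (\<lambda>X. F X + F' X)"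
  "poly_mat F \<Longrightarrow> poly_mat F' \<Longrightarrow> poly_mat (\<lambda>X. F X ** F' X)"
  "p \<in> poly_funs \<Longrightarrow> poly_mat F \<Longrightarrow> poly_mat (\<lambda>X. p X *\<^sub>m F X)"
  unfolding poly_mat_def matrix_matrix_mult_def
  by (auto intro!: poly_funs.intros poly_funs_sum)

lemma poly_funs_trace: "poly_mat F \<Longrightarrow> (\<lambda>X. trace (F X)) \<in> poly_funs"
  unfolding poly_mat_def trace_def by (auto intro!: poly_funs_sum)

lemma zariski_closed_eq:
  assumes "poly_mat F" "poly_mat F'"
  shows "zariski_closed {X. F X = F' X}"
  unfolding zariski_closed_def
proof (intro exI conjI)
  let ?P = "range (\<lambda>(i, j) X. F X $ i $ j - F' X $ i $ j)"
  show "?P \<subseteq> poly_funs"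
    using assms by (auto simp: poly_mat_def intro!: poly_funs_diff)
  show "{X. F X = F' X} = {A. \<forall>p\<in>?P. p A = 0}"
    by (auto simp: vec_eq_iff)
qed

text \<open>
  Separation of outside points by single polynomials avoids choosing a system of equations, which is
  what makes arbitrary intersections easy to handle.
\<close>

lemma zariski_closed_iff:
  "zariski_closed S \<longleftrightarrow> (\<forall>X. X \<notin> S \<longrightarrow> (\<exists>p\<in>poly_funs. (\<forall>A\<in>S. p A = 0) \<and> p X \<noteq> 0))"
proof
  assume "zariski_closed S"
  then obtain P where "P \<subseteq> poly_funs" "S = {A. \<forall>p\<in>P. p A = 0}"
    unfolding zariski_closed_def by blast
  then show "\<forall>X. X \<notin> S \<longrightarrow> (\<exists>p\<in>poly_funs. (\<forall>A\<in>S. p A = 0) \<and> p X \<noteq> 0)"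
    by auto
next
  assume sep: "\<forall>X. X \<notin> S \<longrightarrow> (\<exists>p\<in>poly_funs. (\<forall>A\<in>S. p A = 0) \<and> p X \<noteq> 0)"
  let ?P = "{p \<in> poly_funs. \<forall>A\<in>S. p A = 0}"
  have "S = {A. \<forall>p\<in>?P. p A = 0}"
  proof (intro subset_antisym subsetI)
    fix X assume "X \<in> {A. \<forall>p\<in>?P. p A = 0}"
    then show "X \<in> S" using sep by blast
  qed simp
  then show "zariski_closed S"
    unfolding zariski_closed_def by (intro exI[of _ ?P]) blast
qed

lemma zariski_closed_All:
  assumes "\<And>i. zariski_closed {X. Q i X}"
  shows "zariski_closed {X. \<forall>i. Q i X}"
  unfolding zariski_closed_iff
proof (intro allI impI)
  fix X assume "X \<notin> {X. \<forall>i. Q i X}"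
  then obtain i where "X \<notin> {X. Q i X}" by blast
  then obtain p where "p \<in> poly_funs" "\<forall>A\<in>{X. Q i X}. p A = 0" "p X \<noteq> 0"
    using assms[of i] unfolding zariski_closed_iff by blast
  then show "\<exists>p\<in>poly_funs. (\<forall>A\<in>{X. \<forall>i. Q i X}. p A = 0) \<and> p X \<noteq> 0"
    by (intro bexI[of _ p] conjI) simp_all
qed

lemma zariski_closed_conj:
  assumes "zariski_closed {X. Q X}" "zariski_closed {X. R X}"
  shows "zariski_closed {X. Q X \<and> R X}"
proof -
  have "zariski_closed {X. \<forall>b. if b then Q X else R X}"
  proof (rule zariski_closed_All)
    show "zariski_closed {X. if b then Q X else R X}" for b
      using assms by (cases b) simp_all
  qed
  then show ?thesis
    by (simp add: all_bool_eq conj_commute)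
qed

lemma zariski_closure_iff:
  "Y \<in> zariski_closure S \<longleftrightarrow> (\<forall>p\<in>poly_funs. (\<forall>A\<in>S. p A = 0) \<longrightarrow> p Y = 0)"
proof
  assume Y: "Y \<in> zariski_closure S"
  show "\<forall>p\<in>poly_funs. (\<forall>A\<in>S. p A = 0) \<longrightarrow> p Y = 0"
  proof (intro ballI impI)
    fix p assume p: "p \<in> poly_funs" "\<forall>A\<in>S. p A = 0"
    have "zariski_closed {A. p A = 0}"
      unfolding zariski_closed_def using p(1) by (intro exI[of _ "{p}"]) auto
    then have "zariski_closure S \<subseteq> {A. p A = 0}"
      unfolding zariski_closure_def using p(2) by (intro hull_minimal) auto
    then show "p Y = 0" using Y by blast
  qed
next
  assume Y: "\<forall>p\<in>poly_funs. (\<forall>A\<in>S. p A = 0) \<longrightarrow> p Y = 0"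
  have "Y \<in> Z" if "zariski_closed Z" "S \<subseteq> Z" for Z
  proof (rule ccontr)
    assume "Y \<notin> Z"
    then obtain p where p: "p \<in> poly_funs" "\<forall>A\<in>Z. p A = 0" "p Y \<noteq> 0"
      using \<open>zariski_closed Z\<close> unfolding zariski_closed_iff by blast
    have "\<forall>A\<in>S. p A = 0"
      using p(2) \<open>S \<subseteq> Z\<close> by blast
    then show False using Y p by blast
  qed
  then show "Y \<in> zariski_closure S"
    unfolding zariski_closure_def hull_def by blast
qed

lemma degenerates_refl: "degenerates X X"
  by (simp add: degenerates_def zariski_closure_def hull_subset)

lemma degenerates_trans: "degenerates X Y \<Longrightarrow> degenerates Y Z \<Longrightarrow> degenerates X Z"
  unfolding degenerates_def zariski_closure_def
  using hull_mono[of "G_orbit Y" "zariski_closed hull G_orbit X" zariski_closed] by simp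

lemma degenerates_in_closed:
  assumes "degenerates X Y" "zariski_closed {Z. Q Z}" "\<And>Z. Z \<in> G_orbit X \<Longrightarrow> Q Z"
  shows "Q Y"
proof -
  have "zariski_closure (G_orbit X) \<subseteq> {Z. Q Z}"
    unfolding zariski_closure_def using assms(2,3) by (intro hull_minimal) auto
  then show ?thesis
    using assms(1) G_orbit_refl[of Y] unfolding degenerates_def by blast
qed

text \<open>
  Over a finite field the product of all linear factors \<open>x - a\<close>, increased by 1, would be a nonconstant
  polynomial without roots.
\<close>

lemma infinite_alg_closed: "infinite (UNIV :: 'a::alg_closed_field set)"
proof
  assume fin: "finite (UNIV :: 'a set)"
  define q :: "'a poly" where "q = (\<Prod>a\<in>UNIV. [:- a, 1:]) + 1"
  have "degree (\<Prod>a\<in>(UNIV::'a set). [:- a, 1:]) = card (UNIV :: 'a set)"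
    by (subst degree_prod_eq_sum_degree) auto
  then have "degree q = card (UNIV :: 'a set)"
    unfolding q_def using fin
    by (subst degree_add_eq_left) (auto simp: card_gt_0_iff)
  then have "degree q > 0"
    using fin by (simp add: card_gt_0_iff)
  then obtain x where "poly q x = 0"
    using alg_closed_imp_poly_has_root by blast
  moreover have "poly (\<Prod>a\<in>(UNIV::'a set). [:- a, 1:]) x = 0"
    using fin by (simp add: poly_prod prod_zero_iff)
  ultimately show False by (simp add: q_def)
qed

lemma poly_funs_curve:
  assumes "p \<in> poly_funs" "\<And>i j. \<exists>q. \<forall>t. fst (\<phi> t) $ i $ j = poly q t"
    "\<And>i j. \<exists>q. \<forall>t. snd (\<phi> t) $ i $ j = poly q t"
  shows "\<exists>q. \<forall>t. p (\<phi> t) = poly q t"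
  using assms(1)
proof induction
  case (const c)
  show ?case by (rule exI[of _ "[:c:]"]) simp
next
  case (add p q)
  then show ?case by (metis poly_add)
next
  case (mult p q)
  then show ?case by (metis poly_mult)
qed (use assms in auto)

lemma poly_funs_comp:
  assumes "p \<in> poly_funs" "poly_mat (\<lambda>X. fst (f X))" "poly_mat (\<lambda>X. snd (f X))"
  shows "(\<lambda>X. p (f X)) \<in> poly_funs"
  using assms(1)
  by induction (use assms(2,3) in \<open>auto simp: poly_mat_def intro: poly_funs.intros\<close>)

lemma poly_mat_act:
  "poly_mat (\<lambda>X. fst (conj_act g (shear l m X)))" "poly_mat (\<lambda>X. snd (conj_act g (shear l m X)))"
  unfolding conj_act_def shear_def fst_conv snd_conv
  by (auto intro!: poly_mat_intros poly_funs.intros)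

text \<open>
  A polynomial function that vanishes on the orbit of \<open>X\<close> restricts along the curve to a polynomial in
  one variable with a root at every nonzero element of an infinite field; so it vanishes at the origin
  of the curve too. The group element carrying \<open>\<phi> 0\<close> to an arbitrary point of the orbit of \<open>Y\<close> moves
  the whole curve along.
\<close>

lemma degenerates_curve:
  fixes \<phi> :: "'a::alg_closed_field \<Rightarrow> 'a mat_pair"
  assumes "\<And>i j. \<exists>q. \<forall>t. fst (\<phi> t) $ i $ j = poly q t"
    "\<And>i j. \<exists>q. \<forall>t. snd (\<phi> t) $ i $ j = poly q t"
    and X: "\<And>t. t \<noteq> 0 \<Longrightarrow> \<phi> t \<in> G_orbit X" and Y: "\<phi> 0 \<in> G_orbit Y"
  shows "degenerates X Y"
  unfolding degenerates_def
proof (rule subsetI)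
  fix Z assume "Z \<in> G_orbit Y"
  then have "Z \<in> G_orbit (\<phi> 0)"
    using Y by (simp add: G_orbit_eq)
  then obtain g l m where g: "g \<in> GL" "m \<noteq> 0" and Z: "Z = conj_act g (shear l m (\<phi> 0))"
    by (rule G_orbitE)
  show "Z \<in> zariski_closure (G_orbit X)"
    unfolding zariski_closure_iff
  proof (intro ballI impI)
    fix p assume p: "p \<in> poly_funs" "\<forall>A\<in>G_orbit X. p A = 0"
    obtain q where q: "\<And>t. p (conj_act g (shear l m (\<phi> t))) = poly q t"
      using poly_funs_curve[OF poly_funs_comp[OF p(1) poly_mat_act] assms(1,2)] by metis
    have "poly q t = 0" if "t \<noteq> 0" for t
      using p(2) G_orbit_trans[OF X[OF that] G_orbitI[OF g]] q by metis
    then have "UNIV - {0} \<subseteq> {t. poly q t = 0}" by auto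
    then have "infinite {t. poly q t = 0}"
      using infinite_alg_closed finite_subset by (metis infinite_remove)
    then have "q = 0" using poly_roots_finite by blast
    then show "p Z = 0" using q Z by simp
  qed
qed

section \<open>Normal forms of strictly lower triangular pairs\<close>

text \<open>
  The arguments are the entries at positions 21, 32, 31, in this order: those of the two steps of the
  flag first, the corner last.
\<close>

definition slt :: "'a::field \<Rightarrow> 'a \<Rightarrow> 'a \<Rightarrow> 'a^3^3"
  where "slt a b c = vector [vector [0, 0, 0], vector [a, 0, 0], vector [c, b, 0]]"

lemma slt_nth [simp]:
  "slt a b c $ 1 $ j = 0" "slt a b c $ i $ 3 = 0" "slt a b c $ 2 $ 1 = a"
  "slt a b c $ 2 $ 2 = 0" "slt a b c $ 3 $ 1 = c" "slt a b c $ 3 $ 2 = b"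
  using exhaust_3[of i] exhaust_3[of j] by (auto simp: slt_def)

lemma slt_eq_iff [simp]: "slt a b c = slt a' b' c' \<longleftrightarrow> a = a' \<and> b = b' \<and> c = c'"
  by (auto simp: vec_eq_iff forall_3)

lemma slt_0: "slt 0 0 0 = 0"
  by (simp add: vec_eq_iff forall_3)

lemma slt_0_iff [simp]: "slt a b c = 0 \<longleftrightarrow> a = 0 \<and> b = 0 \<and> c = 0"
  by (metis slt_0 slt_eq_iff)

lemma slt_add: "slt a b c + slt a' b' c' = slt (a + a') (b + b') (c + c')"
  by (simp add: vec_eq_iff forall_3)

lemma slt_scale: "l *\<^sub>m slt a b c = slt (l * a) (l * b) (l * c)"
  by (simp add: vec_eq_iff forall_3)

lemma slt_mult: "slt a b c ** slt a' b' c' = slt 0 0 (b * a')"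
  by (simp add: vec_eq_iff forall_3 matrix_matrix_mult_def sum_3)

lemma mat_unit_slt: "mat_unit 2 1 = slt 1 0 0" "mat_unit 3 2 = slt 0 1 0" "mat_unit 3 1 = slt 0 0 1"
  by (simp_all add: vec_eq_iff forall_3 mat_unit_def)

lemma pairs_slt:
  "pair_A l m = (slt 1 1 0, slt l (l + m) 0)"
  "pair_A_linf l = (slt 1 0 0, slt l 1 0)"
  "pair_A_infl l = (slt 0 1 0, slt 1 l 0)"
  "pair_B l m = (slt 1 1 0, slt l l m)"
  "pair_B_infl l = (slt 0 0 l, slt 1 1 0)"
  "pair_C = (slt 1 0 0, slt 0 0 1)"
  "pair_D = (slt 0 0 1, slt 0 1 0)"
  "pair_E l = (slt 1 0 0, slt l 0 0)"
  "pair_E_inf = (slt 0 0 0, slt 1 0 0)"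
  "pair_O = (slt 0 0 0, slt 0 0 0)"
  by (simp_all add: pair_A_def pair_A_linf_def pair_A_infl_def pair_B_def pair_B_infl_def pair_C_def
      pair_D_def pair_E_def pair_E_inf_def pair_O_def mat_unit_slt slt_add slt_scale slt_0)

datatype orbit_type = TA | TA_linf | TA_infl | TB1 | TB0 | TB_inf0 | TB_inf1 | TC | TD | TE | TE_inf | TO

fun rep :: "orbit_type \<Rightarrow> 'a::field mat_pair" where
  "rep TA = pair_A 0 1"
| "rep TA_linf = pair_A_linf 0"
| "rep TA_infl = pair_A_infl 0"
| "rep TB1 = pair_B 0 1"
| "rep TB0 = pair_B 0 0"
| "rep TB_inf0 = pair_B_infl 0"
| "rep TB_inf1 = pair_B_infl 1"
| "rep TC = pair_C"
| "rep TD = pair_D"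
| "rep TE = pair_E 0"
| "rep TE_inf = pair_E_inf"
| "rep TO = pair_O"

fun normal_forms :: "orbit_type \<Rightarrow> 'a::field mat_pair set" where
  "normal_forms TA = {pair_A l m | l m. m \<noteq> 0}"
| "normal_forms TA_linf = {pair_A_linf l | l. True}"
| "normal_forms TA_infl = {pair_A_infl l | l. True}"
| "normal_forms TB1 = {pair_B l m | l m. m \<noteq> 0}"
| "normal_forms TB0 = {pair_B l 0 | l. True}"
| "normal_forms TB_inf0 = {pair_B_infl 0}"
| "normal_forms TB_inf1 = {pair_B_infl l | l. l \<noteq> 0}"
| "normal_forms TC = {pair_C}"
| "normal_forms TD = {pair_D}"
| "normal_forms TE = {pair_E l | l. True}"
| "normal_forms TE_inf = {pair_E_inf}"
| "normal_forms TO = {pair_O}"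

text \<open>
  The products \<open>a * b'\<close> and \<open>a' * b\<close> are compared instead of the ratios of \<open>(a, a')\<close> and \<open>(b, b')\<close>, so
  the conditions are polynomial and remain meaningful when entries vanish.
\<close>

fun shape :: "orbit_type \<Rightarrow> 'a::field \<Rightarrow> 'a \<Rightarrow> 'a \<Rightarrow> 'a \<Rightarrow> 'a \<Rightarrow> 'a \<Rightarrow> bool" where
  "shape TA a b c a' b' c' \<longleftrightarrow> a \<noteq> 0 \<and> b \<noteq> 0 \<and> a * b' \<noteq> a' * b"
| "shape TA_linf a b c a' b' c' \<longleftrightarrow> a \<noteq> 0 \<and> b = 0 \<and> b' \<noteq> 0"
| "shape TA_infl a b c a' b' c' \<longleftrightarrow> a = 0 \<and> b \<noteq> 0 \<and> a' \<noteq> 0"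
| "shape TB1 a b c a' b' c' \<longleftrightarrow> a \<noteq> 0 \<and> b \<noteq> 0 \<and> a * b' = a' * b \<and> a * c' \<noteq> a' * c"
| "shape TB0 a b c a' b' c' \<longleftrightarrow> a \<noteq> 0 \<and> b \<noteq> 0 \<and> a * b' = a' * b \<and> a * c' = a' * c"
| "shape TB_inf0 a b c a' b' c' \<longleftrightarrow> a = 0 \<and> b = 0 \<and> c = 0 \<and> a' \<noteq> 0 \<and> b' \<noteq> 0"
| "shape TB_inf1 a b c a' b' c' \<longleftrightarrow> a = 0 \<and> b = 0 \<and> c \<noteq> 0 \<and> a' \<noteq> 0 \<and> b' \<noteq> 0"
| "shape TC a b c a' b' c' \<longleftrightarrow> b = 0 \<and> b' = 0 \<and> a * c' \<noteq> a' * c"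
| "shape TD a b c a' b' c' \<longleftrightarrow> a = 0 \<and> a' = 0 \<and> b * c' \<noteq> b' * c"
| "shape TE a b c a' b' c' \<longleftrightarrow> (b = 0 \<and> b' = 0 \<and> a * c' = a' * c \<and> (a \<noteq> 0 \<or> c \<noteq> 0)) \<or>
     (a = 0 \<and> a' = 0 \<and> b * c' = b' * c \<and> (b \<noteq> 0 \<or> c \<noteq> 0))"
| "shape TE_inf a b c a' b' c' \<longleftrightarrow> a = 0 \<and> b = 0 \<and> c = 0 \<and> (a' = 0 \<or> b' = 0) \<and>
     (a' \<noteq> 0 \<or> b' \<noteq> 0 \<or> c' \<noteq> 0)"
| "shape TO a b c a' b' c' \<longleftrightarrow> a = 0 \<and> b = 0 \<and> c = 0 \<and> a' = 0 \<and> b' = 0 \<and> c' = 0"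

lemma exists_shape: "\<exists>t. shape t a b c a' b' c'"
proof -
  have "shape TA a b c a' b' c' \<or> shape TA_linf a b c a' b' c' \<or> shape TA_infl a b c a' b' c' \<or>
    shape TB1 a b c a' b' c' \<or> shape TB0 a b c a' b' c' \<or> shape TB_inf0 a b c a' b' c' \<or>
    shape TB_inf1 a b c a' b' c' \<or> shape TC a b c a' b' c' \<or> shape TD a b c a' b' c' \<or>
    shape TE a b c a' b' c' \<or> shape TE_inf a b c a' b' c' \<or> shape TO a b c a' b' c'"
    by (cases "a = 0"; cases "b = 0"; cases "a' = 0"; cases "b' = 0"; auto)
  then show ?thesis by blast
qed

text \<open>
  The vectors \<open>x\<close>, \<open>y\<close>, \<open>z\<close> are the images of the standard basis vectors, that is the columns of the
  conjugating matrix. The hypotheses state that its determinant is nonzero and that the pair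
  \<open>slt a b c\<close>, \<open>slt a' b' c'\<close> acts on the basis \<open>x, y, z\<close> as the given pair acts on the standard one:
  each matrix maps \<open>x\<close> into the span of \<open>y\<close> and \<open>z\<close>, maps \<open>y\<close> to a multiple of \<open>z\<close>, and kills \<open>z\<close>.
\<close>

lemma GL3_sat_basis_change:
  assumes "(slt p q r, slt p' q' r') \<in> S"
    and "x1 * (y2 * z3 - y3 * z2) + y1 * (x3 * z2 - x2 * z3) + z1 * (x2 * y3 - x3 * y2) \<noteq> 0"
    and "p * y1 + r * z1 = 0" "p * y2 + r * z2 = a * x1" "p * y3 + r * z3 = c * x1 + b * x2"
    and "q * z1 = 0" "q * z2 = a * y1" "q * z3 = c * y1 + b * y2"
    and "a * z1 = 0" "c * z1 + b * z2 = 0"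
    and "p' * y1 + r' * z1 = 0" "p' * y2 + r' * z2 = a' * x1" "p' * y3 + r' * z3 = c' * x1 + b' * x2"
    and "q' * z1 = 0" "q' * z2 = a' * y1" "q' * z3 = c' * y1 + b' * y2"
    and "a' * z1 = 0" "c' * z1 + b' * z2 = 0"
  shows "(slt a b c, slt a' b' c') \<in> GL3_sat S"
proof -
  define g :: "'a^3^3" where
    "g = vector [vector [x1, y1, z1], vector [x2, y2, z2], vector [x3, y3, z3]]"
  have det: "det g \<noteq> 0"
    using assms(2) by (simp add: g_def det_3 algebra_simps)
  have "(slt a b c, slt a' b' c') = conj_act g (slt p q r, slt p' q' r')"
    using det
  proof (rule conj_actI)
    show "g ** slt p q r = slt a b c ** g" "g ** slt p' q' r' = slt a' b' c' ** g"
      using assms(3-)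
      by (simp_all add: g_def vec_eq_iff forall_3 matrix_matrix_mult_def sum_3 mult.commute)
  qed
  then show ?thesis
    using det assms(1) by (auto simp: GL3_sat_def GL_iff_det)
qed

text \<open>
  As far as possible the new basis is generated by the pair itself. Where one of the two matrices, say \<open>N\<close>, is to become
  \<open>E21 + E32\<close>, take \<open>x\<close>, \<open>N x\<close>, \<open>N (N x)\<close>; in the other cases use whichever of the two matrices
  connects the basis vectors in the normal form, and complete by a vector in the common kernel. For the
  three \<open>A\<close> shapes the start vector is \<open>x = (1, s, 0)\<close>, and \<open>s\<close> is chosen such that the entry at position
  31 disappears.
\<close>

lemma shape_normal_form:
  assumes "shape t a b c a' b' c'"
  shows "(slt a b c, slt a' b' c') \<in> GL3_sat (normal_forms t)"
proof (cases t)
  case TA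
  obtain s where s: "s * (a * b' - a' * b) = a' * c - a * c'"
    using TA assms by (metis eq_iff_diff_eq_0 nonzero_eq_divide_eq shape.simps(1))
  have "(slt 1 1 0, slt (a' / a) (b' / b) 0) \<in> normal_forms t"
  proof -
    have "(slt 1 1 0, slt (a' / a) (b' / b) 0) = pair_A (a' / a) (b' / b - a' / a)"
      by (simp add: pairs_slt)
    moreover have "b' / b - a' / a \<noteq> 0"
      using TA assms by (simp add: field_simps)
    ultimately show ?thesis
      unfolding TA normal_forms.simps by blast
  qed
  then show ?thesis
    by (rule GL3_sat_basis_change[of _ _ _ _ _ _ _ 1 a "a * b" "c + s * b" 0 0 0 s 0])
      (use TA assms s in \<open>auto simp: field_simps\<close>)
next
  case TA_linf
  let ?s = "(a' * c / a - c') / b'"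
  have "(slt 1 0 0, slt (a' / a) 1 0) \<in> normal_forms t"
    using TA_linf by (auto simp: pairs_slt)
  then show ?thesis
    by (rule GL3_sat_basis_change[of _ _ _ _ _ _ _ 1 a "a * b'" c 0 0 0 ?s 0])
      (use TA_linf assms in \<open>auto simp: field_simps\<close>)
next
  case TA_infl
  let ?s = "- c / b"
  have "(slt 0 1 0, slt 1 (b' / b) 0) \<in> normal_forms t"
    using TA_infl by (auto simp: pairs_slt)
  then show ?thesis
    by (rule GL3_sat_basis_change[of _ _ _ _ _ _ _ 1 a' "a' * b" "c' + ?s * b'" 0 0 0 ?s 0])
      (use TA_infl assms in \<open>auto simp: field_simps\<close>)
next
  case TB1
  have "(slt 1 1 0, slt (a' / a) (a' / a) ((a * c' - a' * c) / (a * a * b))) \<in> normal_forms t"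
    using TB1 assms by (auto simp: pairs_slt)
  then show ?thesis
    by (rule GL3_sat_basis_change[of _ _ _ _ _ _ _ 1 a "a * b" c 0 0 0 0 0])
      (use TB1 assms in \<open>auto simp: field_simps\<close>)
next
  case TB0
  have "(slt 1 1 0, slt (a' / a) (a' / a) 0) \<in> normal_forms t"
    using TB0 assms by (auto simp: pairs_slt)
  then show ?thesis
    by (rule GL3_sat_basis_change[of _ _ _ _ _ _ _ 1 a "a * b" c 0 0 0 0 0])
      (use TB0 assms in \<open>auto simp: field_simps\<close>)
next
  case TB_inf0
  have "(slt 0 0 0, slt 1 1 0) \<in> normal_forms t"
    using TB_inf0 assms by (auto simp: pairs_slt)
  then show ?thesis
    by (rule GL3_sat_basis_change[of _ _ _ _ _ _ _ 1 a' "a' * b'" c' 0 0 0 0 0])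
      (use TB_inf0 assms in \<open>auto simp: field_simps\<close>)
next
  case TB_inf1
  have "(slt 0 0 (c / (a' * b')), slt 1 1 0) \<in> normal_forms t"
    using TB_inf1 assms by (auto simp: pairs_slt)
  then show ?thesis
    by (rule GL3_sat_basis_change[of _ _ _ _ _ _ _ 1 a' "a' * b'" c' 0 0 0 0 0])
      (use TB_inf1 assms in \<open>auto simp: field_simps\<close>)
next
  case TC
  have "(slt 1 0 0, slt 0 0 1) \<in> normal_forms t"
    using TC by (auto simp: pairs_slt)
  then show ?thesis
    by (rule GL3_sat_basis_change[of _ _ _ _ _ _ _ 1 a c' c a' 0 0 0 0])
      (use TC assms in \<open>auto simp: field_simps\<close>)
next
  case TD
  \<comment> \<open>The first two basis vectors are killed by the second and by the first matrix, respectively.\<close>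
  have "(slt 0 0 1, slt 0 1 0) \<in> normal_forms t"
    using TD by (auto simp: pairs_slt)
  moreover have "b' * (c * (c * b' - b * c')) + - b * (c' * (c * b' - b * c')) \<noteq> 0"
  proof -
    have "(c * b' - b * c') * (c * b' - b * c') \<noteq> 0"
      using TD assms by (auto simp: mult.commute)
    then show ?thesis by (simp add: algebra_simps)
  qed
  ultimately show ?thesis
    using TD assms
    by (intro GL3_sat_basis_change[of _ _ _ _ _ _ _ b' c "c * b' - b * c'" 0 0 "- b" 0 "- c'" 0])
      (auto simp: mult.commute)
next
  case TE
  have nf: "(slt 1 0 0, slt l 0 0) \<in> normal_forms t" for l
    using TE by (auto simp: pairs_slt)
  consider "b = 0" "b' = 0" "a \<noteq> 0" "a * c' = a' * c" | "b = 0" "b' = 0" "a = 0" "a' = 0" "c \<noteq> 0"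
    | "a = 0" "a' = 0" "b \<noteq> 0" "b * c' = b' * c"
    using TE assms by (cases "a = 0"; cases "b = 0"; auto)
  then show ?thesis
  proof cases
    case 1
    show ?thesis
      by (rule GL3_sat_basis_change[OF nf[of "a' / a"], of 1 a 1 c 0 0 0 0 0])
        (use 1 in \<open>auto simp: field_simps\<close>)
  next
    case 2
    show ?thesis
      by (rule GL3_sat_basis_change[OF nf[of "c' / c"], of 1 0 0 c 1 0 0 0 0])
        (use 2 in \<open>auto simp: field_simps\<close>)
  next
    case 3
    show ?thesis
      by (rule GL3_sat_basis_change[OF nf[of "b' / b"], of 0 0 0 b "- c" 0 0 1 b])
        (use 3 in \<open>auto simp: field_simps\<close>)
  qed
next
  case TE_inf
  have nf: "(slt 0 0 0, slt 1 0 0) \<in> normal_forms t"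
    using TE_inf by (auto simp: pairs_slt)
  consider "b' = 0" "a' \<noteq> 0" | "b' = 0" "a' = 0" "c' \<noteq> 0" | "a' = 0" "b' \<noteq> 0"
    using TE_inf assms by auto
  then show ?thesis
  proof cases
    case 1
    show ?thesis
      by (rule GL3_sat_basis_change[OF nf, of 1 a' 1 c' 0 0 0 0 0])
        (use TE_inf assms 1 in \<open>auto simp: field_simps\<close>)
  next
    case 2
    show ?thesis
      by (rule GL3_sat_basis_change[OF nf, of 1 0 0 c' 1 0 0 0 0])
        (use TE_inf assms 2 in \<open>auto simp: field_simps\<close>)
  next
    case 3
    show ?thesis
      by (rule GL3_sat_basis_change[OF nf, of 0 0 0 b' "- c'" 0 0 1 b'])
        (use TE_inf assms 3 in \<open>auto simp: field_simps\<close>)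
  qed
next
  case TO
  have "(slt 0 0 0, slt 0 0 0) \<in> normal_forms t"
    using TO by (auto simp: pairs_slt)
  then show ?thesis
    by (rule GL3_sat_basis_change[of _ _ _ _ _ _ _ 1 1 1 0 0 0 0 0 0])
      (use TO assms in auto)
qed

text \<open>
  All normal forms arise from the representative by an element of \<open>H\<close>, with one exception: conjugation
  preserves the factor \<open>l\<close> in \<open>(l (N ** N), N)\<close>, and rescaling \<open>N\<close> by \<open>1 / k\<close> multiplies it by
  \<open>k ^ 2\<close>, so a square root of \<open>l\<close> is needed.
\<close>

lemma normal_forms_in_orbit:
  assumes "(X :: 'a::alg_closed_field mat_pair) \<in> normal_forms t"
  shows "X \<in> G_orbit (rep t)"
proof (cases "t = TB_inf1")
  case True
  then obtain l where l: "l \<noteq> 0" "X = (slt 0 0 l, slt 1 1 0)"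
    using assms by (auto simp: pairs_slt)
  obtain k where k: "k ^ 2 = l"
    using nth_root_exists[of 2 l] by auto
  then have "k \<noteq> 0" using l by auto
  have "X \<in> GL3_sat {shear 0 (1 / k) (rep t)}"
    unfolding l(2)
    by (rule GL3_sat_basis_change[of 0 0 1 "1 / k" "1 / k" 0 _ 1 k l 0 0 0 0 0 0])
      (use True l k \<open>k \<noteq> 0\<close> in \<open>auto simp: shear_def pairs_slt slt_scale slt_add field_simps power2_eq_square\<close>)
  then show ?thesis
    using \<open>k \<noteq> 0\<close> by (auto simp: GL3_sat_def intro!: G_orbitI)
next
  case False
  have "\<exists>l m. m \<noteq> 0 \<and> X = shear l m (rep t)"
    using assms False
    by (cases t) (auto simp: shear_def pairs_slt slt_scale slt_add intro: exI[of _ 1])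
  then show ?thesis
    using G_orbit_of_shear by blast
qed

lemma shear_rep_shape:
  assumes "m \<noteq> 0"
  obtains a b c a' b' c' where "shear l m (rep t) = (slt a b c, slt a' b' c')" "shape t a b c a' b' c'"
proof -
  have "\<exists>a b c a' b' c'. shear l m (rep t) = (slt a b c, slt a' b' c') \<and> shape t a b c a' b' c'"
    using assms by (cases t) (simp_all add: shear_def pairs_slt slt_scale slt_add)
  then show ?thesis using that by blast
qed

lemma G_orbit_rep: "G_orbit (rep t :: 'a::alg_closed_field mat_pair) = GL3_sat (normal_forms t)"
proof (intro subset_antisym subsetI)
  fix Y :: "'a mat_pair" assume "Y \<in> G_orbit (rep t)"
  then obtain g l m where g: "g \<in> GL" "m \<noteq> 0" "Y = conj_act g (shear l m (rep t))"
    by (rule G_orbitE)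
  have "shear l m (rep t) \<in> GL3_sat (normal_forms t :: 'a mat_pair set)"
    using g(2) by (metis shear_rep_shape shape_normal_form)
  then obtain h F where "h \<in> GL" "F \<in> normal_forms t" "shear l m (rep t) = conj_act h F"
    by (auto simp: GL3_sat_def)
  then show "Y \<in> GL3_sat (normal_forms t)"
    using g GL_mult[of g h] unfolding GL3_sat_def
    by (intro CollectI exI[of _ "g ** h"] exI[of _ F]) (simp add: conj_act_mult)
next
  fix Y :: "'a mat_pair" assume "Y \<in> GL3_sat (normal_forms t)"
  then show "Y \<in> G_orbit (rep t)"
    using normal_forms_in_orbit G_orbit_conj G_orbit_trans
    unfolding GL3_sat_def by blast
qed

lemma shape_in_orbit:
  "shape t a b c a' b' c' \<Longrightarrow> (slt a b c, slt a' b' c') \<in> G_orbit (rep t :: 'a::alg_closed_field mat_pair)"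
  using shape_normal_form G_orbit_rep by blast

section \<open>Degenerations along curves of triangular pairs\<close>

text \<open>
  The Hasse diagram, as a relation on the labels of the orbits.
\<close>

inductive edge :: "orbit_type \<Rightarrow> orbit_type \<Rightarrow> bool" where
  "edge TA TA_linf"
| "edge TA TA_infl"
| "edge TA TB1"
| "edge TB1 TB0"
| "edge TB1 TB_inf1"
| "edge TA_linf TB_inf1"
| "edge TA_infl TB_inf1"
| "edge TB_inf1 TC"
| "edge TB_inf1 TD"
| "edge TB_inf1 TB_inf0"
| "edge TB0 TB_inf0"
| "edge TB0 TE"
| "edge TB_inf0 TE_inf"
| "edge TC TE"
| "edge TD TE"
| "edge TE TE_inf"
| "edge TE_inf TO"

lemma degenerates_shape_curve:
  fixes a b c a' b' c' :: "'a::alg_closed_field poly"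
  assumes "\<And>t. t \<noteq> 0 \<Longrightarrow> shape s (poly a t) (poly b t) (poly c t) (poly a' t) (poly b' t) (poly c' t)"
    and "shape s' (poly a 0) (poly b 0) (poly c 0) (poly a' 0) (poly b' 0) (poly c' 0)"
  shows "degenerates (rep s :: 'a mat_pair) (rep s')"
proof (rule degenerates_curve)
  let ?\<phi> = "\<lambda>t. (slt (poly a t) (poly b t) (poly c t), slt (poly a' t) (poly b' t) (poly c' t))"
  have poly_slt: "\<exists>q. \<forall>t. slt (poly a t) (poly b t) (poly c t) $ i $ j = poly q t"
    for a b c :: "'a poly" and i j
    using exhaust_3[of i] exhaust_3[of j] by (auto intro: exI[of _ 0])
  show "\<exists>q. \<forall>t. fst (?\<phi> t) $ i $ j = poly q t" "\<exists>q. \<forall>t. snd (?\<phi> t) $ i $ j = poly q t" for i j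
    by (simp_all add: poly_slt)
  show "?\<phi> t \<in> G_orbit (rep s)" if "t \<noteq> 0" for t
    using assms(1)[OF that] by (rule shape_in_orbit)
  show "?\<phi> 0 \<in> G_orbit (rep s')"
    using assms(2) by (rule shape_in_orbit)
qed

text \<open>
  In each case the curve is affine linear in its parameter, which is the polynomial \<open>[:0, 1:]\<close>.
\<close>

lemma edge_degenerates:
  assumes "edge s s'"
  shows "degenerates (rep s :: 'a::alg_closed_field mat_pair) (rep s')"
  using assms
proof cases
  case 1
  show ?thesis unfolding 1 by (rule degenerates_shape_curve[of _ 1 "[:0, 1:]" 0 0 1 0]) auto
next
  case 2
  show ?thesis unfolding 2 by (rule degenerates_shape_curve[of _ "[:0, 1:]" 1 0 1 0 0]) auto
next
  case 3
  show ?thesis unfolding 3 by (rule degenerates_shape_curve[of _ 1 1 0 0 "[:0, 1:]" 1]) auto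
next
  case 4
  show ?thesis unfolding 4 by (rule degenerates_shape_curve[of _ 1 1 0 0 0 "[:0, 1:]"]) auto
next
  case 5
  show ?thesis unfolding 5 by (rule degenerates_shape_curve[of _ "[:0, 1:]" "[:0, 1:]" 1 1 1 0]) auto
next
  case 6
  show ?thesis unfolding 6 by (rule degenerates_shape_curve[of _ "[:0, 1:]" 0 1 1 1 0]) auto
next
  case 7
  show ?thesis unfolding 7 by (rule degenerates_shape_curve[of _ 0 "[:0, 1:]" 1 1 1 0]) auto
next
  case 8
  show ?thesis unfolding 8 by (rule degenerates_shape_curve[of _ 0 0 1 1 "[:0, 1:]" 0]) auto
next
  case 9
  show ?thesis unfolding 9 by (rule degenerates_shape_curve[of _ 0 0 1 "[:0, 1:]" 1 0]) auto
next
  case 10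
  show ?thesis unfolding 10 by (rule degenerates_shape_curve[of _ 0 0 "[:0, 1:]" 1 1 0]) auto
next
  case 11
  show ?thesis unfolding 11 by (rule degenerates_shape_curve[of _ "[:0, 1:]" "[:0, 1:]" 0 1 1 0]) auto
next
  case 12
  show ?thesis unfolding 12 by (rule degenerates_shape_curve[of _ 1 "[:0, 1:]" 0 0 0 0]) auto
next
  case 13
  show ?thesis unfolding 13 by (rule degenerates_shape_curve[of _ 0 0 0 1 "[:0, 1:]" 0]) auto
next
  case 14
  show ?thesis unfolding 14 by (rule degenerates_shape_curve[of _ 1 0 0 0 0 "[:0, 1:]"]) auto
next
  case 15
  show ?thesis unfolding 15 by (rule degenerates_shape_curve[of _ 0 1 0 0 0 "[:0, 1:]"]) auto
next
  case 16
  show ?thesis unfolding 16 by (rule degenerates_shape_curve[of _ "[:0, 1:]" 0 0 1 0 0]) auto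
next
  case 17
  show ?thesis unfolding 17 by (rule degenerates_shape_curve[of _ 0 0 0 "[:0, 1:]" 0 0]) auto
qed

section \<open>Closed conditions invariant under the group\<close>

datatype condition = TriplesZero | FstZero | BothZero | ProductsZero | FstSquareZero | Proportional |
  Commuting | FstKillsLeft | FstKillsRight | RowRankOne | ColRankOne

text \<open>
  In \<open>Proportional\<close>, \<open>RowRankOne\<close> and \<open>ColRankOne\<close> the test matrix \<open>M\<close> ranges over everything, so that
  conjugation of the pair by \<open>g\<close> is compensated by conjugating \<open>M\<close> back; written out, the equations are the
  vanishing of 2 by 2 minors. The first of the three is linear dependence. For the other two note that
  \<open>A = u v\<^sup>T\<close> and \<open>B = w v\<^sup>T\<close> give \<open>A M B = (v\<^sup>T M w) A = trace (M B) A\<close>: for nonzero \<open>A\<close>,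
  \<open>RowRankOne\<close> states that the rows of \<open>A\<close> and \<open>B\<close> together span a line, and \<open>ColRankOne\<close> states the same
  for columns. These two distinguish \<open>pair_C\<close> from \<open>pair_D\<close>.
\<close>

fun satisfies :: "condition \<Rightarrow> 'a::field mat_pair \<Rightarrow> bool" where
  "satisfies TriplesZero X \<longleftrightarrow>
     (\<forall>P\<in>{fst X, snd X}. \<forall>Q\<in>{fst X, snd X}. \<forall>R\<in>{fst X, snd X}. P ** Q ** R = 0)"
| "satisfies FstZero X \<longleftrightarrow> fst X = 0"
| "satisfies BothZero X \<longleftrightarrow> fst X = 0 \<and> snd X = 0"
| "satisfies ProductsZero X \<longleftrightarrow> (\<forall>P\<in>{fst X, snd X}. \<forall>Q\<in>{fst X, snd X}. P ** Q = 0)"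
| "satisfies FstSquareZero X \<longleftrightarrow> fst X ** fst X = 0"
| "satisfies Proportional X \<longleftrightarrow>
     (\<forall>M. trace (M ** fst X) *\<^sub>m snd X = trace (M ** snd X) *\<^sub>m fst X)"
| "satisfies Commuting X \<longleftrightarrow> fst X ** snd X = snd X ** fst X"
| "satisfies FstKillsLeft X \<longleftrightarrow> fst X ** fst X = 0 \<and> fst X ** snd X = 0"
| "satisfies FstKillsRight X \<longleftrightarrow> fst X ** fst X = 0 \<and> snd X ** fst X = 0"
| "satisfies RowRankOne X \<longleftrightarrow> (\<forall>M. fst X ** M ** fst X = trace (M ** fst X) *\<^sub>m fst X \<and>
     fst X ** M ** snd X = trace (M ** snd X) *\<^sub>m fst X)"
| "satisfies ColRankOne X \<longleftrightarrow> (\<forall>M. fst X ** M ** fst X = trace (M ** fst X) *\<^sub>m fst X \<and>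
     snd X ** M ** fst X = trace (M ** snd X) *\<^sub>m fst X)"

lemma zariski_closed_satisfies: "zariski_closed {X :: 'a::field mat_pair. satisfies c X}"
  by (cases c)
    (simp_all, (intro zariski_closed_conj zariski_closed_All zariski_closed_eq poly_mat_intros poly_funs_trace)+)

lemma matrix_mult_0 [simp]: "A ** 0 = 0" "0 ** A = 0" for A :: "'a::field^3^3"
  by (simp_all add: vec_eq_iff matrix_matrix_mult_def)

text \<open>
  This transports conjugation from the pair to the test matrix.
\<close>

lemma trace_conj: "trace (M ** (g ** A ** h)) = trace (h ** M ** g ** A)" for A :: "'a::field^3^3"
  by (metis matrix_mul_assoc trace_mul_sym)

lemma satisfies_conj_act:
  assumes g: "g \<in> GL" and X: "satisfies c X"
  shows "satisfies c (conj_act g X)"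
proof -
  let ?h = "matrix_inv g"
  have pull: "g ** A ** ?h ** M ** (g ** B ** ?h) = g ** (A ** (?h ** M ** g) ** B) ** ?h" for A B M
    by (simp add: matrix_mul_assoc)
  have scale: "d *\<^sub>m (g ** A ** ?h) = g ** (d *\<^sub>m A) ** ?h" for d A
    by (simp add: mat_scale_algebra)
  have cong: "A = B \<Longrightarrow> g ** A ** ?h = g ** B ** ?h" for A B
    by simp
  show ?thesis
    using X by (cases c) (auto simp: conj_act_def conj_mult[OF g] pull scale trace_conj
      intro!: cong)
qed

lemma satisfies_shear:
  assumes X: "satisfies c X"
  shows "satisfies c (shear l m X)"
proof (cases "c = Proportional")
  case True
  have "(m * trace (M ** fst X)) *\<^sub>m snd X = (m * trace (M ** snd X)) *\<^sub>m fst X" for M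
    using X True by (simp flip: mat_scale_scale)
  then show ?thesis
    using True by (simp add: shear_def mat_scale_algebra trace_add trace_mat_scale mult.commute)
next
  case False
  then show ?thesis
    using X by (cases c)
      (auto simp: shear_def mat_scale_algebra trace_add trace_mat_scale add.commute mult.commute)
qed

lemma satisfies_G_orbit: "satisfies c X \<Longrightarrow> Y \<in> G_orbit X \<Longrightarrow> satisfies c Y"
  by (metis G_orbitE satisfies_conj_act satisfies_shear)

lemma satisfies_degenerates: "degenerates X Y \<Longrightarrow> satisfies c X \<Longrightarrow> satisfies c Y"
  by (rule degenerates_in_closed[OF _ zariski_closed_satisfies]) (auto intro: satisfies_G_orbit)

lemma trace_mult_slt: "trace (M ** slt a b c) = M $ 1 $ 2 * a + M $ 2 $ 3 * b + M $ 1 $ 3 * c"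
  by (simp add: trace_def matrix_matrix_mult_def sum_3 algebra_simps)

lemma slt_sandwich: "slt a b c ** M ** slt a' b' c' = 
  vector [vector [0, 0, 0], 
   vector [a * (M $ 1 $ 2 * a' + M $ 1 $ 3 * c'), a * M $ 1 $ 3 * b', 0],
   vector [c * (M $ 1 $ 2 * a' + M $ 1 $ 3 * c') + b * (M $ 2 $ 2 * a' + M $ 2 $ 3 * c'), 
     (c * M $ 1 $ 3 + b * M $ 2 $ 3) * b', 0]]"
  by (simp add: vec_eq_iff forall_3 matrix_matrix_mult_def sum_3 algebra_simps)

lemma satisfies_slt:
  "satisfies TriplesZero (slt a b c, slt a' b' c')"
  "satisfies FstZero (slt a b c, slt a' b' c') \<longleftrightarrow> a = 0 \<and> b = 0 \<and> c = 0"
  "satisfies BothZero (slt a b c, slt a' b' c') \<longleftrightarrow>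
     a = 0 \<and> b = 0 \<and> c = 0 \<and> a' = 0 \<and> b' = 0 \<and> c' = 0"
  "satisfies ProductsZero (slt a b c, slt a' b' c') \<longleftrightarrow>
     b * a = 0 \<and> b * a' = 0 \<and> b' * a = 0 \<and> b' * a' = 0"
  "satisfies FstSquareZero (slt a b c, slt a' b' c') \<longleftrightarrow> b * a = 0"
  "satisfies Commuting (slt a b c, slt a' b' c') \<longleftrightarrow> b * a' = b' * a"
  "satisfies FstKillsLeft (slt a b c, slt a' b' c') \<longleftrightarrow> b * a = 0 \<and> b * a' = 0"
  "satisfies FstKillsRight (slt a b c, slt a' b' c') \<longleftrightarrow> b * a = 0 \<and> b' * a = 0"
  by (auto simp: slt_mult)

lemma satisfies_Proportional_slt:
  "satisfies Proportional (slt a b c, slt a' b' c') \<longleftrightarrow> a * b' = a' * b \<and> a * c' = a' * c \<and> b * c' = b' * c"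
    (is "?L \<longleftrightarrow> ?R")
proof
  assume ?L
  then have "trace (M ** slt a b c) *\<^sub>m slt a' b' c' = trace (M ** slt a' b' c') *\<^sub>m slt a b c" for M
    by simp
  from this[of "mat_unit 1 2"] this[of "mat_unit 2 3"]
  show ?R
    by (simp add: trace_mult_slt slt_scale mat_unit_def mult.commute)
next
  assume ?R
  then have "(x * a + y * b + z * c) * a' = (x * a' + y * b' + z * c') * a"
    "(x * a + y * b + z * c) * b' = (x * a' + y * b' + z * c') * b"
    "(x * a + y * b + z * c) * c' = (x * a' + y * b' + z * c') * c" for x y z
    by algebra+
  then show ?L
    by (simp add: trace_mult_slt slt_scale)
qed

lemma satisfies_RowRankOne_slt:
  "satisfies RowRankOne (slt a b c, slt a' b' c') \<longleftrightarrow> a * b = 0 \<and> a * b' = 0 \<and> a' * b = 0 \<and> c * b' = b * c'"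
    (is "?L \<longleftrightarrow> ?R")
proof
  assume ?L
  then have "slt a b c ** M ** slt a b c = trace (M ** slt a b c) *\<^sub>m slt a b c"
    "slt a b c ** M ** slt a' b' c' = trace (M ** slt a' b' c') *\<^sub>m slt a b c" for M
    by simp_all
  from this[of "mat_unit 1 3"] this[of "mat_unit 1 2"] this[of "mat_unit 2 3"]
  show ?R
    by (auto simp: slt_sandwich trace_mult_slt mat_unit_def vec_eq_iff forall_3 algebra_simps)
next
  assume ?R
  then show ?L
    by (auto simp: slt_sandwich trace_mult_slt vec_eq_iff forall_3 algebra_simps)
qed

lemma satisfies_ColRankOne_slt:
  "satisfies ColRankOne (slt a b c, slt a' b' c') \<longleftrightarrow> a * b = 0 \<and> a * b' = 0 \<and> a' * b = 0 \<and> a * c' = a' * c"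
    (is "?L \<longleftrightarrow> ?R")
proof
  assume ?L
  then have "slt a b c ** M ** slt a b c = trace (M ** slt a b c) *\<^sub>m slt a b c"
    "slt a' b' c' ** M ** slt a b c = trace (M ** slt a' b' c') *\<^sub>m slt a b c" for M
    by simp_all
  from this[of "mat_unit 1 3"] this[of "mat_unit 1 2"] this[of "mat_unit 2 3"]
  show ?R
    by (auto simp: slt_sandwich trace_mult_slt mat_unit_def vec_eq_iff forall_3 algebra_simps)
next
  assume ?R
  then show ?L
    by (auto simp: slt_sandwich trace_mult_slt vec_eq_iff forall_3 algebra_simps)
qed

lemmas satisfies_slt_iff = satisfies_slt satisfies_Proportional_slt satisfies_RowRankOne_slt satisfies_ColRankOne_slt

declare satisfies.simps [simp del]

text \<open>
  The conditions that hold for the representative of the orbit, see \<open>satisfies_rep\<close>.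
\<close>

fun profile :: "orbit_type \<Rightarrow> condition set" where
  "profile TA = {TriplesZero}"
| "profile TA_linf = {TriplesZero, FstSquareZero, FstKillsLeft}"
| "profile TA_infl = {TriplesZero, FstSquareZero, FstKillsRight}"
| "profile TB1 = {TriplesZero, Commuting}"
| "profile TB0 = {TriplesZero, Commuting, Proportional}"
| "profile TB_inf1 = {TriplesZero, Commuting, FstSquareZero, FstKillsLeft, FstKillsRight}"
| "profile TB_inf0 = {TriplesZero, Commuting, FstSquareZero, FstKillsLeft, FstKillsRight, FstZero, Proportional, RowRankOne, ColRankOne}"
| "profile TC = {TriplesZero, Commuting, FstSquareZero, FstKillsLeft, FstKillsRight, ProductsZero, RowRankOne}"
| "profile TD = {TriplesZero, Commuting, FstSquareZero, FstKillsLeft, FstKillsRight, ProductsZero, ColRankOne}"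
| "profile TE = {TriplesZero, Commuting, FstSquareZero, FstKillsLeft, FstKillsRight, ProductsZero, Proportional, RowRankOne, ColRankOne}"
| "profile TE_inf = {TriplesZero, Commuting, FstSquareZero, FstKillsLeft, FstKillsRight, FstZero, ProductsZero, Proportional, RowRankOne, ColRankOne}"
| "profile TO = {TriplesZero, Commuting, FstSquareZero, FstKillsLeft, FstKillsRight, FstZero, BothZero, ProductsZero, Proportional,
     RowRankOne, ColRankOne}"

lemma satisfies_rep: "satisfies c (rep t :: 'a::field mat_pair) \<longleftrightarrow> c \<in> profile t"
  by (cases c; cases t) (simp_all add: pairs_slt satisfies_slt_iff)

text \<open>
  The orbits reachable from a label are collected from the bottom of the diagram upwards.
\<close>

lemma profile_subset_edges: "profile s \<subseteq> profile t \<Longrightarrow> edge\<^sup>*\<^sup>* s t"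
proof -
  assume sub: "profile s \<subseteq> profile t"
  have step: "edge r s \<Longrightarrow> edge\<^sup>*\<^sup>* s t \<Longrightarrow> edge\<^sup>*\<^sup>* r t" for r s t
    by (rule converse_rtranclp_into_rtranclp)
  note edges = edge.intros[THEN r_into_rtranclp[of edge]]
  have O: "edge\<^sup>*\<^sup>* TE_inf t" if "t \<in> {TE_inf, TO}" for t
    using that edges by auto
  have E: "edge\<^sup>*\<^sup>* TE t" if "t \<in> {TE, TE_inf, TO}" for t
    using that O[of t] step[OF edge.intros(16), of t] by auto
  have C: "edge\<^sup>*\<^sup>* TC t" if "t \<in> {TC, TE, TE_inf, TO}" for t
    using that E[of t] step[OF edge.intros(14), of t] by auto
  have D: "edge\<^sup>*\<^sup>* TD t" if "t \<in> {TD, TE, TE_inf, TO}" for t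
    using that E[of t] step[OF edge.intros(15), of t] by auto
  have Bi0: "edge\<^sup>*\<^sup>* TB_inf0 t" if "t \<in> {TB_inf0, TE_inf, TO}" for t
    using that O[of t] step[OF edge.intros(13), of t] by auto
  have B0: "edge\<^sup>*\<^sup>* TB0 t" if "t \<in> {TB0, TB_inf0, TE, TE_inf, TO}" for t
    using that E[of t] Bi0[of t] step[OF edge.intros(11), of t] step[OF edge.intros(12), of t] by auto
  have Bi1: "edge\<^sup>*\<^sup>* TB_inf1 t" if "t \<in> {TB_inf1, TC, TD, TB_inf0, TE, TE_inf, TO}" for t
    using that C[of t] D[of t] Bi0[of t] step[OF edge.intros(8), of t] step[OF edge.intros(9), of t]
      step[OF edge.intros(10), of t] by auto
  have B1: "edge\<^sup>*\<^sup>* TB1 t" if "t \<notin> {TA, TA_linf, TA_infl}" for t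
    using that B0[of t] Bi1[of t] step[OF edge.intros(4), of t] step[OF edge.intros(5), of t]
    by (cases t) auto
  have A0i: "edge\<^sup>*\<^sup>* TA_linf t" if "t \<notin> {TA, TA_infl, TB1, TB0}" for t
    using that Bi1[of t] step[OF edge.intros(6), of t] by (cases t) auto
  have Ai0: "edge\<^sup>*\<^sup>* TA_infl t" if "t \<notin> {TA, TA_linf, TB1, TB0}" for t
    using that Bi1[of t] step[OF edge.intros(7), of t] by (cases t) auto
  have A: "edge\<^sup>*\<^sup>* TA t"
    using B1[of t] step[OF edge.intros(1), of t] step[OF edge.intros(2), of t] step[OF edge.intros(3), of t]
    by (cases t) auto
  show ?thesis
  proof (cases s)
    case TA then show ?thesis using A by simp
  next
    case TA_linf then show ?thesis using sub A0i[of t] by (cases t) auto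
  next
    case TA_infl then show ?thesis using sub Ai0[of t] by (cases t) auto
  next
    case TB1 then show ?thesis using sub B1[of t] by (cases t) auto
  next
    case TB0 then show ?thesis using sub B0[of t] by (cases t) auto
  next
    case TB_inf0 then show ?thesis using sub Bi0[of t] by (cases t) auto
  next
    case TB_inf1 then show ?thesis using sub Bi1[of t] by (cases t) auto
  next
    case TC then show ?thesis using sub C[of t] by (cases t) auto
  next
    case TD then show ?thesis using sub D[of t] by (cases t) auto
  next
    case TE then show ?thesis using sub E[of t] by (cases t) auto
  next
    case TE_inf then show ?thesis using sub O[of t] by (cases t) auto
  next
    case TO then show ?thesis using sub by (cases t) auto
  qed
qed

lemma edges_degenerate:
  assumes "edge\<^sup>*\<^sup>* s t"
  shows "degenerates (rep s :: 'a::alg_closed_field mat_pair) (rep t)"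
  using assms by induction (blast intro: degenerates_refl degenerates_trans edge_degenerates)+

text \<open>
  Conditions pass to degenerations, which excludes everything not on a path of edges.
\<close>

lemma degenerates_rep_iff:
  "degenerates (rep s :: 'a::alg_closed_field mat_pair) (rep t) \<longleftrightarrow> profile s \<subseteq> profile t"
proof
  assume "degenerates (rep s :: 'a mat_pair) (rep t)"
  then have "satisfies c (rep s :: 'a mat_pair) \<Longrightarrow> satisfies c (rep t :: 'a mat_pair)" for c
    by (rule satisfies_degenerates)
  then show "profile s \<subseteq> profile t"
    by (auto simp: satisfies_rep)
qed (intro edges_degenerate profile_subset_edges)

section \<open>Nilpotent pairs are simultaneously triangularizable\<close>

text \<open>
  Of a nilpotent algebra containing \<open>A\<close> and \<open>B\<close>, only the vanishing of long words in these two generators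
  enters the triangularization. The same notion also covers pairs of which just the words of length
  three are known to vanish.
\<close>

definition words_vanish :: "nat \<Rightarrow> 'a::field^3^3 \<Rightarrow> 'a^3^3 \<Rightarrow> bool"
  where "words_vanish n A B \<longleftrightarrow>
    (\<forall>ws. length ws = n \<and> set ws \<subseteq> {A, B} \<longrightarrow> foldr (**) ws (mat 1) = 0)"

lemma foldr_mult_right: "foldr (**) ws X = foldr (**) ws (mat 1) ** X" for X :: "'a::field^3^3"
  by (induction ws) (simp_all add: matrix_mul_assoc)

lemma vanishing_power_eigenvalue:
  fixes X :: "'a::field^3^3"
  assumes "foldr (**) (replicate n X) (mat 1) = 0" "X *v y = e *s y" "y \<noteq> 0"
  shows "e = 0"
proof -
  have "foldr (**) (replicate k X) (mat 1) *v y = e ^ k *s y" for k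
    by (induction k)
      (simp_all add: matrix_vector_mul_assoc[symmetric] vector_scalar_commute assms(2) vector_smult_assoc mult.commute)
  from this[of n] have "e ^ n *s y = 0"
    using assms(1) by simp
  then show ?thesis using assms(3) by simp
qed

text \<open>
  Take a nonzero word \<open>W\<close> of maximal length: lengthening it at either end gives zero. It is not empty
  because \<open>A\<close> and \<open>B\<close> are not both zero, and so \<open>W ** W\<close> vanishes as well.
\<close>

lemma words_vanish_annihilator:
  assumes "words_vanish n A B" "A \<noteq> 0 \<or> B \<noteq> 0"
  obtains W where "W \<noteq> 0" "W ** W = 0" "A ** W = 0" "B ** W = 0" "W ** A = 0" "W ** B = 0"
proof -
  define m where "m = (LEAST n. words_vanish n A B)"
  have m: "words_vanish m A B"
    unfolding m_def using assms(1) by (rule LeastI)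
  have "m \<noteq> 0"
  proof
    assume "m = 0"
    then have "(mat 1 :: 'a^3^3) = 0"
      using m by (simp add: words_vanish_def)
    then show False by (simp add: vec_eq_iff forall_3 mat_def)
  qed
  then obtain k where k: "m = Suc k" by (cases m) auto
  have "\<not> words_vanish k A B"
    using not_less_Least[of k "\<lambda>n. words_vanish n A B"] k by (simp add: m_def)
  then obtain ws where ws: "length ws = k" "set ws \<subseteq> {A, B}" "foldr (**) ws (mat 1) \<noteq> 0"
    by (auto simp: words_vanish_def)
  let ?W = "foldr (**) ws (mat 1)"
  have left: "X ** ?W = 0" if "X \<in> {A, B}" for X
    using m that ws k unfolding words_vanish_def by (elim allE[of _ "X # ws"]) auto
  have right: "?W ** X = 0" if "X \<in> {A, B}" for X
    using m that ws k foldr_mult_right[of ws X] unfolding words_vanish_def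
    by (elim allE[of _ "ws @ [X]"]) auto
  have "ws \<noteq> []"
  proof
    assume "ws = []"
    then show False using left[of A] left[of B] assms(2) by simp
  qed
  then obtain X ws' where "ws = X # ws'" by (cases ws) auto
  then have "?W ** ?W = (?W ** X) ** foldr (**) ws' (mat 1)"
    by (simp add: matrix_mul_assoc)
  also have "\<dots> = 0"
    using right[of X] ws(2) \<open>ws = X # ws'\<close> by simp
  finally show ?thesis
    using that[OF ws(3)] left right by simp
qed

text \<open>
  A nonzero column \<open>v\<close> of \<open>W\<close> is a common kernel vector of the matrices killed by multiplication with \<open>W\<close>
  on the right, and a nonzero row \<open>f\<close> of \<open>W\<close> is a linear form that vanishes on the image of every matrix
  killed by multiplication with \<open>W\<close> on the left. As \<open>W ** W = 0\<close>, the vector \<open>v\<close> lies in the kernel of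
  \<open>f\<close>, and there is a basis whose last vector is \<open>v\<close> and whose last two vectors span the kernel of \<open>f\<close>.
  These are the columns of \<open>P\<close>.
\<close>

lemma annihilator_basis:
  fixes W :: "'a::field^3^3"
  assumes "W \<noteq> 0" "W ** W = 0"
  obtains P i d where "P \<in> GL" "d \<noteq> 0"
    "\<And>(X :: 'a^3^3) r. X ** W = 0 \<Longrightarrow> (X ** P) $ r $ 3 = 0"
    "\<And>t. (W ** P) $ i $ t = (if t = 1 then d else 0)"
proof -
  obtain i j where ij: "W $ i $ j \<noteq> 0"
    using assms(1) by (auto simp: vec_eq_iff)
  have WW: "(\<Sum>k\<in>UNIV. W $ i $ k * W $ k $ j) = 0"
    using assms(2) by (simp add: vec_eq_iff matrix_matrix_mult_def)
  \<comment> \<open>Otherwise \<open>v\<close> would be a multiple of \<open>e_j\<close>, on which the linear form does not vanish.\<close>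
  have "\<exists>k. k \<noteq> j \<and> W $ k $ j \<noteq> 0"
  proof (rule ccontr)
    assume "\<not> ?thesis"
    then have z: "W $ k $ j = 0" if "k \<noteq> j" for k using that by blast
    then have "(\<Sum>k\<in>UNIV. W $ i $ k * W $ k $ j) = (\<Sum>k\<in>UNIV. if k = j then W $ i $ k * W $ k $ j else 0)"
      by (intro sum.cong) auto
    then have "W $ i $ j * W $ j $ j = 0" using WW by simp
    then show False using z[of i] ij by (cases "i = j") auto
  qed
  then obtain k where k: "k \<noteq> j" "W $ k $ j \<noteq> 0" by blast
  have "card {j, k} \<noteq> card (UNIV :: 3 set)"
    by (simp add: card_insert_if)
  then have "{j, k} \<noteq> UNIV" by metis
  then obtain q where q: "q \<noteq> j" "q \<noteq> k" by blast
  have univ: "{j, k, q} = UNIV"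
    using k(1) q by (intro card_subset_eq) auto
  have sum_jkq: "sum f UNIV = f j + f k + f q" for f :: "3 \<Rightarrow> 'a"
    unfolding univ[symmetric] using k(1) q by (simp add: add.assoc)
  \<comment> \<open>With \<open>f = W $ i\<close>, the columns are the unit vector \<open>e_j\<close>, the vector \<open>f_j e_q - f_q e_j\<close> in the
    kernel of \<open>f\<close>, and column \<open>j\<close> of \<open>W\<close>.\<close>
  define P :: "'a^3^3" where "P = (\<chi> r s. if s = 1 then (if r = j then 1 else 0)
    else if s = 2 then (if r = q then W $ i $ j else if r = j then - W $ i $ q else 0)
    else W $ r $ j)"
  have "x = 0" if "P *v x = 0" for x
  proof -
    have row: "P $ r $ 1 * x $ 1 + P $ r $ 2 * x $ 2 + P $ r $ 3 * x $ 3 = 0" for r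
      using that by (simp add: vec_eq_iff matrix_vector_mult_def sum_3)
    have x3: "x $ 3 = 0" using row[of k] k q by (simp add: P_def)
    have x2: "x $ 2 = 0" using row[of q] x3 ij q by (simp add: P_def)
    have "x $ 1 = 0" using row[of j] x3 x2 by (simp add: P_def)
    with x2 x3 show ?thesis by (simp add: vec_eq_iff forall_3)
  qed
  then have GL: "P \<in> GL"
    unfolding GL_def by (simp add: invertible_left_inverse matrix_left_invertible_ker)
  have col: "(X ** P) $ r $ 3 = 0" if "X ** W = 0" for X :: "'a^3^3" and r
  proof -
    have "(X ** P) $ r $ 3 = (X ** W) $ r $ j"
      by (simp add: matrix_matrix_mult_def P_def)
    then show ?thesis using that by simp
  qed
  have row: "(W ** P) $ i $ t = (if t = 1 then W $ i $ j else 0)" for t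
  proof -
    have "(W ** P) $ i $ 1 = W $ i $ j" "(W ** P) $ i $ 2 = 0"
      using k q by (simp_all add: matrix_matrix_mult_def sum_jkq P_def)
    moreover have "(W ** P) $ i $ 3 = 0"
      using WW by (simp add: matrix_matrix_mult_def P_def)
    ultimately show ?thesis using exhaust_3[of t] by auto
  qed
  show ?thesis by (rule that[OF GL ij col row])
qed

text \<open>
  In the basis of \<open>annihilator_basis\<close> the last column and the first row of the matrix vanish. The only
  other entry on or above the diagonal is the middle one, an eigenvalue, which is zero because a power
  of the matrix is.
\<close>

lemma slt_conj_if_annihilated:
  fixes P X W :: "'a::field^3^3"
  assumes P: "P \<in> GL" and d: "d \<noteq> 0"
    and col: "\<And>r. (X ** P) $ r $ 3 = 0"
    and row: "\<And>t. (W ** P) $ i $ t = (if t = 1 then d else 0)"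
    and W: "W ** X = 0" and nil: "foldr (**) (replicate n X) (mat 1) = 0"
  shows "\<exists>a b c. X = P ** slt a b c ** matrix_inv P"
proof -
  define M where "M = matrix_inv P ** X ** P"
  have PM: "P ** M = X ** P"
    using P by (simp add: M_def matrix_mul_assoc[symmetric])
  have col3: "M $ r $ 3 = 0" for r
    unfolding M_def matrix_mul_assoc[symmetric] using col
    by (simp add: matrix_matrix_mult_def[of "matrix_inv P"])
  have row1: "M $ 1 $ s = 0" for s
  proof -
    have "0 = (W ** P ** M) $ i $ s"
      using W by (simp add: PM matrix_mul_assoc[symmetric]) (simp add: matrix_mul_assoc)
    also have "\<dots> = d * M $ 1 $ s"
      by (simp add: matrix_matrix_mult_def[of "W ** P"] row sum_3)
    finally show ?thesis using d by simp
  qed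
  \<comment> \<open>The middle column of \<open>M\<close> is an eigenvector for the middle entry.\<close>
  let ?y = "vector [0, M $ 2 $ 2, M $ 3 $ 2] :: 'a^3"
  have My: "M *v ?y = M $ 2 $ 2 *s ?y"
    by (simp add: vec_eq_iff forall_3 matrix_vector_mult_def sum_3 row1 col3 mult.commute)
  have "M $ 2 $ 2 = 0"
  proof (rule ccontr)
    assume nz: "M $ 2 $ 2 \<noteq> 0"
    have "X *v (P *v ?y) = P *v (M *v ?y)"
      by (simp add: matrix_vector_mul_assoc PM)
    also have "\<dots> = M $ 2 $ 2 *s (P *v ?y)"
      by (simp add: My vector_scalar_commute)
    finally have "P *v ?y = 0"
      using vanishing_power_eigenvalue[OF nil] nz by blast
    moreover have "?y = matrix_inv P *v (P *v ?y)"
      by (simp only: matrix_vector_mul_assoc GL_inv(2)[OF P] matrix_vector_mul_lid)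
    ultimately have "?y = 0" by simp
    then show False using nz by (simp add: vec_eq_iff forall_3)
  qed
  then have "M = slt (M $ 2 $ 1) (M $ 3 $ 2) (M $ 3 $ 1)"
    by (simp add: vec_eq_iff forall_3 row1 col3)
  moreover have "X = P ** M ** matrix_inv P"
    using P by (simp add: PM matrix_mul_assoc[symmetric] GL_inv)
  ultimately show ?thesis by metis
qed

lemma words_vanish_triangularizable:
  fixes A B :: "'a::field^3^3"
  assumes words: "words_vanish n A B"
  obtains P a b c a' b' c' where "P \<in> GL" "(A, B) = conj_act P (slt a b c, slt a' b' c')"
proof (cases "A = 0 \<and> B = 0")
  case True
  then show ?thesis using that[OF one_in_GL, of 0 0 0 0 0 0] by (simp add: slt_0)
next
  case False
  then obtain W where W: "W \<noteq> 0" "W ** W = 0" "A ** W = 0" "B ** W = 0" "W ** A = 0" "W ** B = 0"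
    using words_vanish_annihilator[OF words] by blast
  obtain P i d where P: "P \<in> GL" "d \<noteq> 0"
    "\<And>(X :: 'a^3^3) r. X ** W = 0 \<Longrightarrow> (X ** P) $ r $ 3 = 0"
    "\<And>t. (W ** P) $ i $ t = (if t = 1 then d else 0)"
    using annihilator_basis[OF W(1,2)] by metis
  have "\<exists>a b c. X = P ** slt a b c ** matrix_inv P" if X: "X \<in> {A, B}" for X
  proof (rule slt_conj_if_annihilated[OF P(1,2) _ P(4)])
    show "(X ** P) $ r $ 3 = 0" for r
      using X W by (intro P(3)) auto
    show "W ** X = 0" using X W by auto
    show "foldr (**) (replicate n X) (mat 1) = 0"
      using words X unfolding words_vanish_def by (elim allE[of _ "replicate n X"]) auto
  qed
  then obtain a b c a' b' c' where
    "A = P ** slt a b c ** matrix_inv P" "B = P ** slt a' b' c' ** matrix_inv P"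
    by (metis insertI1 insertI2 singletonI)
  then show ?thesis using that[OF P(1)] by (simp add: conj_act_def)
qed

text \<open>
  The conjugates by \<open>P\<close> of strictly lower triangular matrices form an algebra in which all products of
  three elements vanish, and it contains the algebra generated by the pair.
\<close>

lemma triangularizable_nilp_pairs:
  assumes P: "P \<in> GL"
  shows "conj_act P (slt a b c, slt a' b' c') \<in> nilp_pairs"
proof -
  let ?T = "\<lambda>a b c. P ** slt a b c ** matrix_inv P"
  let ?S = "{?T a b c | a b c. True}"
  let ?H = "subalgebra hull {?T a b c, ?T a' b' c'}"
  have add: "?T a b c + ?T a' b' c' = ?T (a + a') (b + b') (c + c')" for a b c a' b' c'
    by (simp flip: slt_add add: mat_scale_algebra)
  have scale: "k *\<^sub>m ?T a b c = ?T (k * a) (k * b) (k * c)" for k a b c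
    by (simp flip: slt_scale add: mat_scale_algebra)
  have mult: "?T a b c ** ?T a' b' c' = ?T 0 0 (b * a')" for a b c a' b' c'
    by (simp add: conj_mult[OF P] slt_mult)
  have zero: "?T 0 0 0 = 0"
    by (simp add: slt_0)
  have "subalgebra ?S"
    unfolding subalgebra_def
    by (intro conjI ballI allI) (use zero in \<open>auto simp: add scale mult\<close>, metis+)
  then have sub: "?H \<subseteq> ?S"
    by (intro hull_minimal) auto
  have "foldr (**) As (mat 1) = 0" if As3: "length As = 3" "set As \<subseteq> ?H" for As
  proof -
    obtain X Y Z where As: "As = [X, Y, Z]"
      using As3(1) unfolding numeral_3_eq_3 length_Suc_conv by auto
    then have "X \<in> ?S" "Y \<in> ?S" "Z \<in> ?S" using As3(2) sub by auto
    then show ?thesis by (auto simp: As mult zero)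
  qed
  then have "nilpotent_algebra ?H"
    unfolding nilpotent_algebra_def by (intro exI[of _ 3]) auto
  then show ?thesis by (simp add: nilp_pairs_def conj_act_def)
qed

lemma nilp_pairs_triangularizable:
  assumes "X \<in> nilp_pairs"
  obtains P a b c a' b' c' where "P \<in> GL" "X = conj_act P (slt a b c, slt a' b' c')"
proof -
  obtain A B where X: "X = (A, B)" by (cases X)
  obtain n where n: "\<And>As. length As = n \<Longrightarrow> set As \<subseteq> subalgebra hull {A, B} \<Longrightarrow> foldr (**) As (mat 1) = 0"
    using assms by (auto simp: X nilp_pairs_def nilpotent_algebra_def)
  have "{A, B} \<subseteq> subalgebra hull {A, B}" by (rule hull_subset)
  then have "words_vanish n A B"
    unfolding words_vanish_def using n by blast
  then show ?thesis
    using words_vanish_triangularizable X that by metis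
qed

lemma nilp_pairs_iff_TriplesZero: "X \<in> nilp_pairs \<longleftrightarrow> satisfies TriplesZero X"
proof
  assume "X \<in> nilp_pairs"
  then show "satisfies TriplesZero X"
    using satisfies_conj_act satisfies_slt_iff(1) by (metis nilp_pairs_triangularizable)
next
  assume X: "satisfies TriplesZero X"
  have "words_vanish 3 (fst X) (snd X)"
    using X by (auto simp: words_vanish_def satisfies.simps length_Suc_conv eval_nat_numeral matrix_mul_assoc)
  then show "X \<in> nilp_pairs"
    using triangularizable_nilp_pairs by (metis words_vanish_triangularizable prod.collapse)
qed

section \<open>The degeneration order\<close>

lemma rep_in_nilp_pairs: "rep t \<in> nilp_pairs"
  by (cases t) (simp_all add: nilp_pairs_iff_TriplesZero satisfies_rep del: rep.simps)

lemma nilp_pairs_orbit_rep: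
  assumes "(X :: 'a::alg_closed_field mat_pair) \<in> nilp_pairs"
  obtains t where "G_orbit X = G_orbit (rep t)"
proof -
  obtain P a b c a' b' c' where P: "P \<in> GL" "X = conj_act P (slt a b c, slt a' b' c')"
    using assms by (rule nilp_pairs_triangularizable)
  obtain t where "shape t a b c a' b' c'" using exists_shape by blast
  then have "X \<in> G_orbit (rep t)"
    using P shape_in_orbit G_orbit_conj G_orbit_trans by blast
  then show ?thesis using that G_orbit_eq by blast
qed

lemma profile_eqD: "profile s = profile t \<Longrightarrow> s = t"
  by (cases s; cases t) auto

lemma G_orbit_rep_eq_iff:
  "G_orbit (rep s :: 'a::alg_closed_field mat_pair) = G_orbit (rep t) \<longleftrightarrow> s = t"
proof
  assume "G_orbit (rep s :: 'a mat_pair) = G_orbit (rep t)"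
  then have "degenerates (rep s :: 'a mat_pair) (rep t)" "degenerates (rep t :: 'a mat_pair) (rep s)"
    using degenerates_refl unfolding degenerates_def by metis+
  then show "s = t"
    by (intro profile_eqD) (simp add: degenerates_rep_iff)
qed simp

lemma edge_profile_gap:
  assumes "edge s t" "profile s \<subseteq> profile r" "profile r \<subseteq> profile t"
  shows "r = s \<or> r = t"
  using assms by (cases rule: edge.cases; cases r; simp)

lemma edge_neq: "edge s t \<Longrightarrow> s \<noteq> t"
  by (induction rule: edge.induct) simp_all

text \<open>
  A pair of labels in the order relation is joined by a path of edges. If nothing lies strictly between
  them, the first edge of the path already ends at the second label. Conversely, no profile lies
  strictly between the profiles at the ends of an edge.
\<close>

lemma edge_iff_profile_cover:
  "edge s t \<longleftrightarrow> s \<noteq> t \<and> profile s \<subseteq> profile t \<and>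
     \<not> (\<exists>r. r \<noteq> s \<and> r \<noteq> t \<and> profile s \<subseteq> profile r \<and> profile r \<subseteq> profile t)"
proof -
  have edge1: "profile s \<subseteq> profile t" if "edge s t" for s t
    using that by cases simp_all
  have edge_profile: "profile s \<subseteq> profile t" if "edge\<^sup>*\<^sup>* s t" for s t
    using that by induction (use edge1 in blast)+
  show ?thesis
  proof
    assume "edge s t"
    then show "s \<noteq> t \<and> profile s \<subseteq> profile t \<and>
     \<not> (\<exists>r. r \<noteq> s \<and> r \<noteq> t \<and> profile s \<subseteq> profile r \<and> profile r \<subseteq> profile t)"
      using edge_profile[OF r_into_rtranclp[of edge]] edge_profile_gap edge_neq by blast
  next
    assume cover: "s \<noteq> t \<and> profile s \<subseteq> profile t \<and>
     \<not> (\<exists>r. r \<noteq> s \<and> r \<noteq> t \<and> profile s \<subseteq> profile r \<and> profile r \<subseteq> profile t)"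
    then have "edge\<^sup>*\<^sup>* s t" by (simp add: profile_subset_edges)
    then obtain r where r: "edge s r" "edge\<^sup>*\<^sup>* r t"
      using cover by (metis converse_rtranclpE)
    then have "profile s \<subseteq> profile r" "profile r \<subseteq> profile t" "r \<noteq> s"
      using edge_profile edge_neq by blast+
    then show "edge s t" using cover r by blast
  qed
qed

text \<open>
  The intermediate orbit in the definition of minimality ranges over all pairs. A degeneration of a
  nilpotent pair satisfies \<open>TriplesZero\<close> and is thus nilpotent, hence it lies in one of the twelve orbits.
\<close>

lemma minimal_degeneration_rep_iff:
  "minimal_degeneration (rep s :: 'a::alg_closed_field mat_pair) (rep t) \<longleftrightarrow> edge s t"
proof -
  have "(\<exists>Z :: 'a mat_pair. G_orbit Z \<noteq> G_orbit (rep s) \<and> G_orbit Z \<noteq> G_orbit (rep t) \<and>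
      degenerates (rep s) Z \<and> degenerates Z (rep t)) \<longleftrightarrow>
    (\<exists>r. r \<noteq> s \<and> r \<noteq> t \<and> profile s \<subseteq> profile r \<and> profile r \<subseteq> profile t)" (is "?L \<longleftrightarrow> ?R")
  proof
    assume ?L
    then obtain Z :: "'a mat_pair" where Z: "G_orbit Z \<noteq> G_orbit (rep s)" "G_orbit Z \<noteq> G_orbit (rep t)"
      "degenerates (rep s) Z" "degenerates Z (rep t)" by blast
    have "Z \<in> nilp_pairs"
      using satisfies_degenerates[OF Z(3)] rep_in_nilp_pairs[of s] by (simp add: nilp_pairs_iff_TriplesZero)
    then obtain r where r: "G_orbit Z = G_orbit (rep r)" by (rule nilp_pairs_orbit_rep)
    then have "degenerates (rep s :: 'a mat_pair) (rep r)" "degenerates (rep r :: 'a mat_pair) (rep t)"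
      using Z by (simp_all add: degenerates_def)
    then show ?R using Z r by (auto simp: degenerates_rep_iff)
  next
    assume ?R
    then obtain r where "r \<noteq> s" "r \<noteq> t" "profile s \<subseteq> profile r" "profile r \<subseteq> profile t" by blast
    then show ?L
      by (intro exI[of _ "rep r"]) (simp add: G_orbit_rep_eq_iff degenerates_rep_iff)
  qed
  then show ?thesis
    unfolding minimal_degeneration_def edge_iff_profile_cover
    by (simp add: G_orbit_rep_eq_iff degenerates_rep_iff)
qed

lemma minimal_degeneration_cong:
  "G_orbit X = G_orbit X' \<Longrightarrow> G_orbit Y = G_orbit Y' \<Longrightarrow> minimal_degeneration X Y = minimal_degeneration X' Y'"
  by (simp add: minimal_degeneration_def degenerates_def)

lemma hasse_diagram:
  "{(G_orbit X, G_orbit Y) | X Y :: 'a::alg_closed_field mat_pair.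
      X \<in> nilp_pairs \<and> Y \<in> nilp_pairs \<and> minimal_degeneration X Y} =
   (\<lambda>(s, t). (G_orbit (rep s), G_orbit (rep t))) ` {(s, t). edge s t}"
proof (intro subset_antisym subsetI)
  fix p :: "'a mat_pair set \<times> 'a mat_pair set"
  assume "p \<in> {(G_orbit X, G_orbit Y) | X Y. X \<in> nilp_pairs \<and> Y \<in> nilp_pairs \<and> minimal_degeneration X Y}"
  then obtain X Y :: "'a mat_pair" where XY: "p = (G_orbit X, G_orbit Y)" "X \<in> nilp_pairs" "Y \<in> nilp_pairs"
    "minimal_degeneration X Y" by blast
  obtain s where s: "G_orbit X = G_orbit (rep s)" using XY(2) by (rule nilp_pairs_orbit_rep)
  obtain t where t: "G_orbit Y = G_orbit (rep t)" using XY(3) by (rule nilp_pairs_orbit_rep)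
  have "edge s t"
    using XY(4) minimal_degeneration_cong[OF s t] by (simp add: minimal_degeneration_rep_iff)
  then show "p \<in> (\<lambda>(s, t). (G_orbit (rep s), G_orbit (rep t))) ` {(s, t). edge s t}"
    using XY(1) s t by auto
next
  fix p :: "'a mat_pair set \<times> 'a mat_pair set"
  assume "p \<in> (\<lambda>(s, t). (G_orbit (rep s), G_orbit (rep t))) ` {(s, t). edge s t}"
  then obtain s t where "edge s t" and p: "p = (G_orbit (rep s), G_orbit (rep t))"
    by auto
  then have "minimal_degeneration (rep s :: 'a mat_pair) (rep t)"
    by (simp add: minimal_degeneration_rep_iff)
  then show "p \<in> {(G_orbit X, G_orbit Y) | X Y. X \<in> nilp_pairs \<and> Y \<in> nilp_pairs \<and> minimal_degeneration X Y}"
    unfolding p using rep_in_nilp_pairs by blast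
qed

lemma UNIV_orbit_type:
  "UNIV = {TA, TA_linf, TA_infl, TB1, TB0, TB_inf0, TB_inf1, TC, TD, TE, TE_inf, TO}"
proof -
  have "t \<in> {TA, TA_linf, TA_infl, TB1, TB0, TB_inf0, TB_inf1, TC, TD, TE, TE_inf, TO}" for t
    by (cases t) simp_all
  then show ?thesis by blast
qed

lemma edge_set:
  "{(s, t). edge s t} =
    {(TA, TA_linf), (TA, TA_infl), (TA, TB1), (TB1, TB0), (TB1, TB_inf1), (TA_linf, TB_inf1),
     (TA_infl, TB_inf1), (TB_inf1, TC), (TB_inf1, TD), (TB_inf1, TB_inf0), (TB0, TB_inf0),
     (TB0, TE), (TB_inf0, TE_inf), (TC, TE), (TD, TE), (TE, TE_inf), (TE_inf, TO)}"
  by (auto simp: edge.simps)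

lemma G_orbit_nilp_pairs: "G_orbit ` (nilp_pairs :: 'a::alg_closed_field mat_pair set) = G_orbit ` range rep"
proof
  show "G_orbit ` (nilp_pairs :: 'a mat_pair set) \<subseteq> G_orbit ` range rep"
    by (rule image_subsetI) (metis nilp_pairs_orbit_rep imageI rangeI)
  show "G_orbit ` range rep \<subseteq> G_orbit ` (nilp_pairs :: 'a mat_pair set)"
    using rep_in_nilp_pairs by (intro image_mono) blast
qed

lemma card_orbits: "card (G_orbit ` (nilp_pairs :: 'a::alg_closed_field mat_pair set)) = 12"
proof -
  have "inj (\<lambda>t. G_orbit (rep t :: 'a mat_pair))"
    by (rule injI) (simp add: G_orbit_rep_eq_iff)
  then have "card (range (\<lambda>t. G_orbit (rep t :: 'a mat_pair))) = card (UNIV :: orbit_type set)"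
    by (rule card_image)
  then show ?thesis
    by (simp add: G_orbit_nilp_pairs image_image UNIV_orbit_type)
qed

theorem proposition7p1:
  shows "card (G_orbit ` (nilp_pairs :: 'a::alg_closed_field mat_pair set)) = 12 \<and>
    G_orbit ` (nilp_pairs :: 'a::alg_closed_field mat_pair set) = G_orbit `
      {pair_A 0 1, pair_A_linf 0, pair_A_infl 0, pair_B 0 1, pair_B 0 0, pair_B_infl 0,
       pair_B_infl 1, pair_C, pair_D, pair_E 0, pair_E_inf, pair_O} \<and>
    (G_orbit (pair_A 0 1) :: 'a::alg_closed_field mat_pair set) = GL3_sat {pair_A l m | l m. m \<noteq> 0} \<and>
    (G_orbit (pair_A_linf 0) :: 'a::alg_closed_field mat_pair set) = GL3_sat {pair_A_linf l | l. True} \<and>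
    (G_orbit (pair_A_infl 0) :: 'a::alg_closed_field mat_pair set) = GL3_sat {pair_A_infl l | l. True} \<and>
    (G_orbit (pair_B 0 1) :: 'a::alg_closed_field mat_pair set) = GL3_sat {pair_B l m | l m. m \<noteq> 0} \<and>
    (G_orbit (pair_B 0 0) :: 'a::alg_closed_field mat_pair set) = GL3_sat {pair_B l 0 | l. True} \<and>
    (G_orbit (pair_B_infl 0) :: 'a::alg_closed_field mat_pair set) = GL3_sat {pair_B_infl 0} \<and>
    (G_orbit (pair_B_infl 1) :: 'a::alg_closed_field mat_pair set) = GL3_sat {pair_B_infl l | l. l \<noteq> 0} \<and>
    (G_orbit pair_C :: 'a::alg_closed_field mat_pair set) = GL3_sat {pair_C} \<and>
    (G_orbit pair_D :: 'a::alg_closed_field mat_pair set) = GL3_sat {pair_D} \<and>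
    (G_orbit (pair_E 0) :: 'a::alg_closed_field mat_pair set) = GL3_sat {pair_E l | l. True} \<and>
    (G_orbit pair_E_inf :: 'a::alg_closed_field mat_pair set) = GL3_sat {pair_E_inf} \<and>
    (G_orbit pair_O :: 'a::alg_closed_field mat_pair set) = {pair_O} \<and>
    {(G_orbit X, G_orbit Y) | X Y :: 'a::alg_closed_field mat_pair.
       X \<in> nilp_pairs \<and> Y \<in> nilp_pairs \<and> minimal_degeneration X Y} =
    (\<lambda>(X, Y). (G_orbit X, G_orbit Y)) `
      {(pair_A 0 1, pair_A_linf 0),
       (pair_A 0 1, pair_A_infl 0),
       (pair_A 0 1, pair_B 0 1),
       (pair_B 0 1, pair_B 0 0),
       (pair_B 0 1, pair_B_infl 1),
       (pair_A_linf 0, pair_B_infl 1),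
       (pair_A_infl 0, pair_B_infl 1),
       (pair_B_infl 1, pair_C),
       (pair_B_infl 1, pair_D),
       (pair_B_infl 1, pair_B_infl 0),
       (pair_B 0 0, pair_B_infl 0),
       (pair_B 0 0, pair_E 0),
       (pair_B_infl 0, pair_E_inf),
       (pair_C, pair_E 0),
       (pair_D, pair_E 0),
       (pair_E 0, pair_E_inf),
       (pair_E_inf, pair_O)}"
proof -
  have reps: "range rep = {pair_A 0 1, pair_A_linf 0, pair_A_infl 0, pair_B 0 1, pair_B 0 0,
      pair_B_infl 0, pair_B_infl 1, pair_C, pair_D, pair_E 0, pair_E_inf, pair_O :: 'a mat_pair}"
    by (simp add: UNIV_orbit_type)
  have O: "GL3_sat {pair_O :: 'a mat_pair} = {pair_O}"
    using one_in_GL by (auto simp: GL3_sat_def conj_act_def pair_O_def)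
  have orbits: "G_orbit (rep t :: 'a mat_pair) = GL3_sat (normal_forms t)" for t
    by (rule G_orbit_rep)
  note orbit = orbits[of TA] orbits[of TA_linf] orbits[of TA_infl] orbits[of TB1] orbits[of TB0]
    orbits[of TB_inf0] orbits[of TB_inf1] orbits[of TC] orbits[of TD] orbits[of TE]
    orbits[of TE_inf] orbits[of TO]
  show ?thesis
    by (intro conjI card_orbits G_orbit_nilp_pairs[where 'a = 'a, unfolded reps]
        orbit[unfolded rep.simps normal_forms.simps O])
      (simp only: hasse_diagram edge_set image_insert image_empty prod.case rep.simps)
qed

end
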